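(* Let $n\geq 5$ and let $\det_n$ denote the $n\times n$ determinant, regarded as a homogeneous polynomial of degree $n$ in $n^2$ variables, i.e. an element of $S^n(\mathbb{C}^{n^2})$. Then: For $n$ even, \[ \underline{R}_s(\det\nolimits_n)\geq\left(1+\frac{8(-8+6n^2+n^3)}{(-1+n)(2+n)(4+n)^2(-2+n^2)}\right)\binom{n}{\frac{n}{2}}^2. \] For $n$ odd, \[ \underline{R}_s(\det\nolimits_n)\geq\left(1+\frac{16(9+8n+n^2)}{(3+n)(5+n)^2(-2+n^2)}\right)\binom{n}{\frac{n-1}{2}}^2. \]
   Context: For a complex vector space $V$ and $P\in S^dV$ (a homogeneous degree $d$ polynomial), the symmetric rank $R_s(P)$ is the least $r$ such that $P=\sum_{i=1}^r v_i^d$ with $v_i\in V$. The symmetric border rank $\underline{R}_s(P)$ is the least $r$ such that $P$ lies in the Zariski closure of the set of elements of $S^dV$ of symmetric rank at most $r$. *)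

theory Defs
  imports
    Complex_Main
    "HOL-Library.Poly_Mapping"
    "HOL-Library.Extended_Nat"
    "HOL-Library.Extended_Real"
    "Jordan_Normal_Form.Determinant"
begin

text \<open>A monomial is a finitely supported exponent function; a polynomial is a finitely supported
  coefficient function on monomials, with the convolution product of \<^theory>\<open>HOL-Library.Poly_Mapping\<close>.\<close>

type_synonym 'x monomial = "'x \<Rightarrow>\<^sub>0 nat"
type_synonym 'x cpoly = "'x monomial \<Rightarrow>\<^sub>0 complex"

definition cvar :: "'x \<Rightarrow> 'x cpoly" where
  "cvar x = Poly_Mapping.single (Poly_Mapping.single x 1) 1"

definition mon_degree :: "'x monomial \<Rightarrow> nat" where
  "mon_degree m = (\<Sum>x\<in>Poly_Mapping.keys m. Poly_Mapping.lookup m x)"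

definition poly_eval :: "'x cpoly \<Rightarrow> ('x \<Rightarrow> complex) \<Rightarrow> complex" where
  "poly_eval F a = (\<Sum>m\<in>Poly_Mapping.keys F. Poly_Mapping.lookup F m *
     (\<Prod>x\<in>Poly_Mapping.keys m. a x ^ Poly_Mapping.lookup m x))"

text \<open>\<open>sym_power X d\<close> is $S^d V$, where $V$ is the complex vector space with basis the variables
  in \<open>X\<close>; in particular $V$ itself is \<open>sym_power X 1\<close>, the space of linear forms.\<close>

definition sym_power :: "'x set \<Rightarrow> nat \<Rightarrow> 'x cpoly set" where
  "sym_power X d =
     {P. \<forall>m\<in>Poly_Mapping.keys P. Poly_Mapping.keys m \<subseteq> X \<and> mon_degree m = d}"

text \<open>Ranks are taken in \<^typ>\<open>enat\<close>, so that the infimum is the least element of the set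
  whenever that set is nonempty.\<close>

definition sym_rank :: "'x set \<Rightarrow> nat \<Rightarrow> 'x cpoly \<Rightarrow> enat" where
  "sym_rank X d P =
     Inf {enat r | r. \<exists>v. (\<forall>i<r. v i \<in> sym_power X 1) \<and> P = (\<Sum>i<r. v i ^ d)}"

text \<open>The polynomial functions on $S^d V$ are the polynomials in the coefficients of its elements,
  so the indeterminates of \<open>F\<close> below are themselves monomials. Indeterminates that are
  not degree \<open>d\<close> monomials in \<open>X\<close> vanish on $S^d V$ and hence give no
  further functions.\<close>

definition zariski_closure :: "'x set \<Rightarrow> nat \<Rightarrow> 'x cpoly set \<Rightarrow> 'x cpoly set" where
  "zariski_closure X d A = {P \<in> sym_power X d. \<forall>F :: 'x monomial cpoly.
     (\<forall>Q\<in>A. poly_eval F (Poly_Mapping.lookup Q) = 0)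
       \<longrightarrow> poly_eval F (Poly_Mapping.lookup P) = 0}"

definition sym_border_rank :: "'x set \<Rightarrow> nat \<Rightarrow> 'x cpoly \<Rightarrow> enat" where
  "sym_border_rank X d P =
     Inf {enat r | r. P \<in> zariski_closure X d {Q \<in> sym_power X d. sym_rank X d Q \<le> enat r}}"

definition mat_vars :: "nat \<Rightarrow> (nat \<times> nat) set" where
  "mat_vars n = {..<n} \<times> {..<n}"

definition det_poly :: "nat \<Rightarrow> (nat \<times> nat) cpoly" where
  "det_poly n = Determinant.det (mat n n cvar)"

end

(*  Let N = n^2. Contracting derivatives of P of order n - k with bivectors and differentiating once
    more gives the Koszul flattening of P: rows (m, p, q), columns (beta, x, y, z), with entry the
    (x, y, z)-coefficient of dc /\ e_p /\ e_q, where c is the (suitably normalised) coefficient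
    functional x |-> P_{beta + m + x}. For P = v^n this has rank at most (N - 1 choose 2), because every
    row is a multiple of v /\ e_p /\ e_q. Ranks of matrices with polynomial entries are lower
    semicontinuous, so border rank times (N - 1 choose 2) bounds the rank of the flattening of det_n.

    For det_n the derivatives are the k x k minors, and the flattening is the exterior derivative
    from 2-forms with coefficients in the minors. The weight x_ij |-> i * j degenerates every minor to
    its diagonal monomial, i.e. to a strict chain in the product order on [n]^2, and the complex becomes
    the direct sum over multidegrees of clique complexes of the comparability graph. A 2-form
    indexed by a k-chain and a pair of variables is discarded for each pair of a (k+1)-chain and a
    variable that is not below the whole chain; for k >= 3 the derivative is injective on the span of
    the remaining 2-forms, by a cocycle argument in each multidegree. Counting
    strict chains gives
      rank >= C(n,k)^2 C(N,2) - C(n,k+1)^2 N + C(n,k+2)^2,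
    and k is taken to be n/2 or (n+1)/2; this is at least 3 when n >= 5.  *)

theory Submission
  imports Defs "HOL-Library.Infinite_Set"
begin

subsection \<open>Polynomial functions\<close>

definition monom_eval :: "('x \<Rightarrow> complex) \<Rightarrow> 'x monomial \<Rightarrow> complex" where
  "monom_eval a m = (\<Prod>x\<in>Poly_Mapping.keys m. a x ^ Poly_Mapping.lookup m x)"

lemma monom_eval_superset:
  assumes "finite S" "Poly_Mapping.keys m \<subseteq> S"
  shows "monom_eval a m = (\<Prod>x\<in>S. a x ^ Poly_Mapping.lookup m x)"
  unfolding monom_eval_def
  by (rule prod.mono_neutral_left) (use assms in \<open>auto simp: in_keys_iff\<close>)

lemma monom_eval_add: "monom_eval a (m + m') = monom_eval a m * monom_eval a m'"
proof -
  let ?S = "Poly_Mapping.keys m \<union> Poly_Mapping.keys m'"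
  have "Poly_Mapping.keys (m + m') \<subseteq> ?S" by (rule Poly_Mapping.keys_add)
  then show ?thesis
    by (simp add: monom_eval_superset[of ?S] lookup_add power_add prod.distrib)
qed

lemma monom_eval_single [simp]: "monom_eval a (Poly_Mapping.single x k) = a x ^ k"
  by (cases "k = 0") (auto simp: monom_eval_def)

lemma poly_eval_superset:
  assumes "finite S" "Poly_Mapping.keys F \<subseteq> S"
  shows "poly_eval F a = (\<Sum>m\<in>S. Poly_Mapping.lookup F m * monom_eval a m)"
  unfolding poly_eval_def monom_eval_def
  by (rule sum.mono_neutral_left) (use assms in \<open>auto simp: in_keys_iff\<close>)

lemma poly_eval_add: "poly_eval (F + G) a = poly_eval F a + poly_eval G a"
proof -
  let ?S = "Poly_Mapping.keys F \<union> Poly_Mapping.keys G"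
  have "Poly_Mapping.keys (F + G) \<subseteq> ?S" by (rule Poly_Mapping.keys_add)
  then show ?thesis
    by (simp add: poly_eval_superset[of ?S] lookup_add ring_distribs sum.distrib)
qed

lemma poly_eval_single [simp]: "poly_eval (Poly_Mapping.single m c) a = c * monom_eval a m"
  by (subst poly_eval_superset[of "{m}"]) auto

lemma poly_eval_zero [simp]: "poly_eval 0 a = 0"
  by (simp add: poly_eval_def)

lemma poly_mapping_eq_sum_single:
  "F = (\<Sum>m\<in>Poly_Mapping.keys F. Poly_Mapping.single m (Poly_Mapping.lookup F m))"
  by (rule poly_mapping_eqI)
     (auto simp: lookup_sum lookup_single when_def in_keys_iff)

lemma poly_eval_sum: "poly_eval (\<Sum>i\<in>I. F i) a = (\<Sum>i\<in>I. poly_eval (F i) a)"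
  by (induction I rule: infinite_finite_induct) (auto simp: poly_eval_add)

lemma poly_eval_mult: "poly_eval (F * G) a = poly_eval F a * poly_eval G a"
proof -
  let ?s = "\<lambda>H m. Poly_Mapping.single m (Poly_Mapping.lookup H m)"
  have "F * G = (\<Sum>m\<in>Poly_Mapping.keys F. ?s F m) * (\<Sum>m\<in>Poly_Mapping.keys G. ?s G m)"
    using poly_mapping_eq_sum_single by metis
  also have "poly_eval \<dots> a = (\<Sum>m\<in>Poly_Mapping.keys F. \<Sum>m'\<in>Poly_Mapping.keys G.
      (Poly_Mapping.lookup F m * monom_eval a m) * (Poly_Mapping.lookup G m' * monom_eval a m'))"
    by (simp add: sum_product poly_eval_sum mult_single monom_eval_add mult_ac)
  also have "\<dots> = poly_eval F a * poly_eval G a"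
    by (simp add: sum_product poly_eval_def monom_eval_def)
  finally show ?thesis .
qed

text \<open>The Zariski closure is tested by polynomials \<open>F\<close>. This predicate provides
  such an \<open>F\<close> for any function assembled from the coefficients by sums and products, in
  particular for a minor.\<close>

definition polynomial_fun :: "(('x \<Rightarrow> complex) \<Rightarrow> complex) \<Rightarrow> bool" where
  "polynomial_fun f \<longleftrightarrow> (\<exists>F. \<forall>a. poly_eval F a = f a)"

lemma polynomial_fun_const: "polynomial_fun (\<lambda>_. c)"
  unfolding polynomial_fun_def
  by (rule exI[of _ "Poly_Mapping.single 0 c"]) (simp add: monom_eval_def)

lemma polynomial_fun_coord: "polynomial_fun (\<lambda>a. a x)"
  unfolding polynomial_fun_def
  by (rule exI[of _ "Poly_Mapping.single (Poly_Mapping.single x 1) 1"]) simp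

lemma polynomial_fun_add:
  "polynomial_fun f \<Longrightarrow> polynomial_fun g \<Longrightarrow> polynomial_fun (\<lambda>a. f a + g a)"
  unfolding polynomial_fun_def by (metis poly_eval_add)

lemma polynomial_fun_mult:
  "polynomial_fun f \<Longrightarrow> polynomial_fun g \<Longrightarrow> polynomial_fun (\<lambda>a. f a * g a)"
  unfolding polynomial_fun_def by (metis poly_eval_mult)

lemma polynomial_fun_sum:
  "(\<And>i. i \<in> I \<Longrightarrow> polynomial_fun (f i)) \<Longrightarrow> polynomial_fun (\<lambda>a. \<Sum>i\<in>I. f i a)"
  by (induction I rule: infinite_finite_induct)
     (auto intro: polynomial_fun_const polynomial_fun_add)

lemma polynomial_fun_prod:
  "(\<And>i. i \<in> I \<Longrightarrow> polynomial_fun (f i)) \<Longrightarrow> polynomial_fun (\<lambda>a. \<Prod>i\<in>I. f i a)"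
  by (induction I rule: infinite_finite_induct)
     (auto intro: polynomial_fun_const polynomial_fun_mult)

lemma polynomial_fun_det:
  assumes "\<And>i j. i < R \<Longrightarrow> j < R \<Longrightarrow> polynomial_fun (f i j)"
  shows "polynomial_fun (\<lambda>a. Determinant.det (mat R R (\<lambda>(i, j). f i j a)))"
proof -
  have "polynomial_fun (\<lambda>a. \<Sum>p\<in>{p. p permutes {0..<R}}. signof p * (\<Prod>i=0..<R. f i (p i) a))"
    by (intro polynomial_fun_sum polynomial_fun_mult polynomial_fun_const polynomial_fun_prod)
       (auto intro!: assms simp: permutes_in_image)
  moreover have "Determinant.det (mat R R (\<lambda>(i, j). f i j a))
      = (\<Sum>p\<in>{p. p permutes {0..<R}}. signof p * (\<Prod>i=0..<R. f i (p i) a))" for a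
    by (subst det_def'[of _ R]) (auto intro!: sum.cong prod.cong simp: permutes_in_image)
  ultimately show ?thesis by simp
qed

subsection \<open>Minors\<close>

lemma det_zero_col:
  assumes "c < R" "\<And>i. i < R \<Longrightarrow> f i c = 0"
  shows "Determinant.det (mat R R (\<lambda>(i, j). f i j)) = (0 :: 'a :: comm_ring_1)"
proof -
  have "(\<Prod>j<R. mat R R (\<lambda>(i, j). f i j) $$ (p j, j)) = 0" if "p permutes {0..<R}" for p
    by (rule prod_zero) (use assms that in \<open>auto intro!: bexI[of _ c] simp: permutes_in_image\<close>)
  then show ?thesis
    by (subst det_col[of _ R]) auto
qed

lemma det_factorization_zero:
  fixes f :: "nat \<Rightarrow> nat \<Rightarrow> 'a :: comm_ring_1"
  assumes "finite L" "card L < R"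
    and f: "\<And>i j. i < R \<Longrightarrow> j < R \<Longrightarrow> f i j = (\<Sum>l\<in>L. A i l * B l j)"
  shows "Determinant.det (mat R R (\<lambda>(i, j). f i j)) = 0"
proof -
  obtain e where e: "bij_betw e {..<card L} L"
    using ex_bij_betw_nat_finite[OF \<open>finite L\<close>] by (auto simp: atLeast0LessThan)
  \<comment> \<open>Padding both factors with zeros to size \<open>R\<close> makes the determinant
    multiplicative on them; since \<open>card L < R\<close>, column \<open>card L\<close> of the
    left factor is zero.\<close>
  let ?A = "mat R R (\<lambda>(i, l). if l < card L then A i (e l) else 0)"
  let ?B = "mat R R (\<lambda>(l, j). if l < card L then B (e l) j else 0)"
  have "mat R R (\<lambda>(i, j). f i j) = ?A * ?B"
  proof (rule eq_matI)
    fix i j assume ij: "i < dim_row (?A * ?B)" "j < dim_col (?A * ?B)"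
    have "f i j = (\<Sum>l<card L. A i (e l) * B (e l) j)"
      using f[of i j] ij sum.reindex_bij_betw[OF e, of "\<lambda>l. A i l * B l j"] by simp
    also have "\<dots> = (\<Sum>l<R. (if l < card L then A i (e l) else 0) * (if l < card L then B (e l) j else 0))"
      using \<open>card L < R\<close> by (intro sum.mono_neutral_cong_left) auto
    finally show "mat R R (\<lambda>(i, j). f i j) $$ (i, j) = (?A * ?B) $$ (i, j)"
      using ij by (simp add: scalar_prod_def atLeast0LessThan)
  qed auto
  also have "Determinant.det \<dots> = Determinant.det ?A * Determinant.det ?B"
    by (rule det_mult) auto
  also have "Determinant.det ?A = 0"
    by (rule det_zero_col[of "card L"]) (use assms in auto)
  finally show ?thesis by simp
qed

text \<open>Induction on the number of rows. A nonzero minor of size \<open>R\<close> is bordered by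
  one more row and a free column \<open>x\<close>; expansion along that column is a combination of
  the rows at \<open>x\<close> whose last coefficient is the old minor. Independence supplies an
  \<open>x\<close> where it does not vanish.\<close>

lemma independent_imp_minor:
  fixes f :: "nat \<Rightarrow> 'c \<Rightarrow> 'a :: field"
  assumes "\<And>a i. (\<And>c. c \<in> C \<Longrightarrow> (\<Sum>i<R. a i * f i c) = 0) \<Longrightarrow> i < R \<Longrightarrow> a i = 0"
  shows "\<exists>c. (\<forall>j<R. c j \<in> C) \<and> Determinant.det (mat R R (\<lambda>(i, j). f i (c j))) \<noteq> 0"
  using assms
proof (induction R)
  case 0
  then show ?case by auto
next
  case (Suc R)
  have "a i = 0" if "\<And>c. c \<in> C \<Longrightarrow> (\<Sum>i<R. a i * f i c) = 0" "i < R" for a i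
    using Suc.prems[of "\<lambda>i. if i < R then a i else 0" i] that by simp
  then obtain c where cC: "\<And>j. j < R \<Longrightarrow> c j \<in> C"
    and c: "Determinant.det (mat R R (\<lambda>(i, j). f i (c j))) \<noteq> 0"
    using Suc.IH by blast
  let ?M = "\<lambda>x. mat (Suc R) (Suc R) (\<lambda>(i, j). f i ((c(R := x)) j))"
  \<comment> \<open>Cofactors along the last column do not depend on its entries, so
    \<open>undefined\<close> may stand there.\<close>
  define K where "K i = cofactor (?M undefined) i R" for i
  have del: "mat_delete (?M x) i R = mat_delete (?M undefined) i R" for x i
    by (rule eq_matI) (auto simp: mat_delete_def)
  have cof: "cofactor (?M x) i R = K i" for x i
    unfolding cofactor_def K_def by (simp only: del[of x i])
  have expand: "Determinant.det (?M x) = (\<Sum>i<Suc R. K i * f i x)" for x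
  proof -
    have "Determinant.det (?M x) = (\<Sum>i<Suc R. ?M x $$ (i, R) * cofactor (?M x) i R)"
      by (rule laplace_expansion_column) auto
    also have "\<dots> = (\<Sum>i<Suc R. K i * f i x)"
      unfolding cof by (rule sum.cong) (auto simp: mult.commute)
    finally show ?thesis .
  qed
  have "mat_delete (?M undefined) R R = mat R R (\<lambda>(i, j). f i (c j))"
    by (rule eq_matI) (auto simp: mat_delete_def)
  then have "K R = Determinant.det (mat R R (\<lambda>(i, j). f i (c j)))"
    unfolding cofactor_def K_def by simp
  then have "K R \<noteq> 0" using c by simp
  then obtain x where "x \<in> C" "(\<Sum>i<Suc R. K i * f i x) \<noteq> 0"
    using Suc.prems[of K R] by blast
  then have "Determinant.det (?M x) \<noteq> 0" using expand by simp
  then show ?case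
    using cC \<open>x \<in> C\<close> by (intro exI[of _ "c(R := x)"]) (simp add: less_Suc_eq)
qed

subsection \<open>The Koszul flattening of a sum of powers of linear forms\<close>

definition fact_prod :: "'x monomial \<Rightarrow> complex" where
  "fact_prod \<alpha> = (\<Prod>x\<in>Poly_Mapping.keys \<alpha>. fact (Poly_Mapping.lookup \<alpha> x))"

text \<open>With this normalisation the coefficients of $v^d$ are those of a rank-one tensor, \<open>d! v\<^sup>\<alpha>\<close>.\<close>

definition dcoef :: "('x monomial \<Rightarrow> complex) \<Rightarrow> 'x monomial \<Rightarrow> complex" where
  "dcoef a \<alpha> = fact_prod \<alpha> * a \<alpha>"

abbreviation evar :: "'x \<Rightarrow> 'x monomial" where
  "evar x \<equiv> Poly_Mapping.single x (Suc 0)"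

section \<open>Degrees and factorials of exponent vectors\<close>

lemma fact_prod_superset:
  assumes "finite S" "Poly_Mapping.keys \<alpha> \<subseteq> S"
  shows "fact_prod \<alpha> = (\<Prod>x\<in>S. fact (Poly_Mapping.lookup \<alpha> x))"
  unfolding fact_prod_def
  by (rule prod.mono_neutral_left) (use assms in \<open>auto simp: in_keys_iff\<close>)

lemma mon_degree_superset:
  assumes "finite S" "Poly_Mapping.keys \<alpha> \<subseteq> S"
  shows "mon_degree \<alpha> = (\<Sum>x\<in>S. Poly_Mapping.lookup \<alpha> x)"
  unfolding mon_degree_def
  by (rule sum.mono_neutral_left) (use assms in \<open>auto simp: in_keys_iff\<close>)

lemma mon_degree_add: "mon_degree (\<alpha> + \<beta>) = mon_degree \<alpha> + mon_degree \<beta>"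
proof -
  let ?S = "Poly_Mapping.keys \<alpha> \<union> Poly_Mapping.keys \<beta>"
  have "Poly_Mapping.keys (\<alpha> + \<beta>) \<subseteq> ?S" by (rule Poly_Mapping.keys_add)
  then show ?thesis by (simp add: mon_degree_superset[of ?S] lookup_add sum.distrib)
qed

lemma mon_degree_single [simp]: "mon_degree (Poly_Mapping.single x k) = k"
  by (cases "k = 0") (auto simp: mon_degree_def)

lemma fact_prod_evar_add:
  "fact_prod (evar x + \<alpha>) = of_nat (Poly_Mapping.lookup (evar x + \<alpha>) x) * fact_prod \<alpha>"
proof -
  let ?S = "insert x (Poly_Mapping.keys \<alpha>)"
  have sub: "Poly_Mapping.keys (evar x + \<alpha>) \<subseteq> ?S"
    using Poly_Mapping.keys_add[of "evar x" \<alpha>] by auto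
  have "fact_prod (evar x + \<alpha>) = (\<Prod>y\<in>?S. fact (Poly_Mapping.lookup (evar x + \<alpha>) y))"
    by (rule fact_prod_superset) (use sub in auto)
  also have "\<dots> = fact (Suc (Poly_Mapping.lookup \<alpha> x)) *
      (\<Prod>y\<in>?S - {x}. fact (Poly_Mapping.lookup (evar x + \<alpha>) y))"
    by (subst prod.remove[of _ x]) (auto simp: lookup_add)
  also have "(\<Prod>y\<in>?S - {x}. fact (Poly_Mapping.lookup (evar x + \<alpha>) y))
      = (\<Prod>y\<in>?S - {x}. fact (Poly_Mapping.lookup \<alpha> y) :: complex)"
    by (rule prod.cong) (auto simp: lookup_add lookup_single)
  also have "fact (Suc (Poly_Mapping.lookup \<alpha> x)) * \<dots>
      = of_nat (Suc (Poly_Mapping.lookup \<alpha> x)) * (\<Prod>y\<in>?S. fact (Poly_Mapping.lookup \<alpha> y))"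
    by (subst prod.remove[of ?S x]) auto
  also have "(\<Prod>y\<in>?S. fact (Poly_Mapping.lookup \<alpha> y)) = fact_prod \<alpha>"
    by (rule fact_prod_superset[symmetric]) auto
  finally show ?thesis by (simp add: lookup_add)
qed

lemma lookup_single_mult:
  "Poly_Mapping.lookup (Poly_Mapping.single m c * (Q :: 'x cpoly)) (m + \<alpha>) = c * Poly_Mapping.lookup Q \<alpha>"
proof -
  have "Poly_Mapping.single m c * Q = (\<Sum>m'\<in>Poly_Mapping.keys Q.
      Poly_Mapping.single (m + m') (c * Poly_Mapping.lookup Q m'))"
    by (subst poly_mapping_eq_sum_single[of Q]) (simp add: sum_distrib_left mult_single)
  then have "Poly_Mapping.lookup (Poly_Mapping.single m c * Q) (m + \<alpha>)
      = (\<Sum>m'\<in>Poly_Mapping.keys Q. if m' = \<alpha> then c * Poly_Mapping.lookup Q m' else 0)"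
    by (simp add: lookup_sum lookup_single when_def)
  then show ?thesis by (simp add: in_keys_iff)
qed

lemma lookup_single_mult_eq_zero:
  assumes "\<And>\<alpha>'. \<alpha> \<noteq> m + \<alpha>'"
  shows "Poly_Mapping.lookup (Poly_Mapping.single m c * (Q :: 'x cpoly)) \<alpha> = 0"
proof -
  have "Poly_Mapping.single m c * Q = (\<Sum>m'\<in>Poly_Mapping.keys Q.
      Poly_Mapping.single (m + m') (c * Poly_Mapping.lookup Q m'))"
    by (subst poly_mapping_eq_sum_single[of Q]) (simp add: sum_distrib_left mult_single)
  then show ?thesis
    using assms[symmetric] by (simp add: lookup_sum lookup_single when_def)
qed

lemma evar_add_exists_iff: "(\<exists>\<alpha>'. \<alpha> = evar x + \<alpha>') \<longleftrightarrow> Poly_Mapping.lookup \<alpha> x \<noteq> (0 :: nat)"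
proof
  assume nz: "Poly_Mapping.lookup \<alpha> x \<noteq> 0"
  have "\<alpha> = evar x + (\<alpha> - evar x)"
    by (rule poly_mapping_eqI) (use nz in \<open>auto simp: lookup_add lookup_minus lookup_single when_def\<close>)
  then show "\<exists>\<alpha>'. \<alpha> = evar x + \<alpha>'" ..
qed (auto simp: lookup_add)

lemma mon_degree_1D:
  assumes "mon_degree m = 1"
  shows "\<exists>x. m = evar x"
proof -
  have "Poly_Mapping.keys m \<noteq> {}" using assms by (auto simp: mon_degree_def)
  then obtain x where "x \<in> Poly_Mapping.keys m" by blast
  then obtain m' where m: "m = evar x + m'" using evar_add_exists_iff[of m x] by (auto simp: in_keys_iff)
  then have "mon_degree m' = 0" using assms by (simp add: mon_degree_add)
  then have "m' = 0" by (auto simp: mon_degree_def in_keys_iff intro!: poly_mapping_eqI)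
  then show ?thesis using m by auto
qed

section \<open>Linear forms and the coefficients of their powers\<close>

definition lin_coef :: "'x cpoly \<Rightarrow> 'x \<Rightarrow> complex" where
  "lin_coef v x = Poly_Mapping.lookup v (evar x)"

lemma evar_inject [simp]:
  "Poly_Mapping.single x (Suc 0) = Poly_Mapping.single y (Suc 0) \<longleftrightarrow> x = y"
  by (metis lookup_single_eq lookup_single_not_eq nat.distinct(1))

lemma lin_coef_outside:
  assumes "v \<in> sym_power X 1" "x \<notin> X"
  shows "lin_coef v x = 0"
proof (rule ccontr)
  assume "lin_coef v x \<noteq> 0"
  then have "evar x \<in> Poly_Mapping.keys v" by (simp add: lin_coef_def in_keys_iff)
  then show False using assms by (auto simp: sym_power_def)
qed

lemma linear_form_eq:
  assumes "finite X" "v \<in> sym_power X 1"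
  shows "v = (\<Sum>x\<in>X. Poly_Mapping.single (evar x) (lin_coef v x))"
proof (rule poly_mapping_eqI)
  fix m
  show "Poly_Mapping.lookup v m
      = Poly_Mapping.lookup (\<Sum>x\<in>X. Poly_Mapping.single (evar x) (lin_coef v x)) m"
  proof (cases "\<exists>x. m = evar x")
    case True
    then obtain x where x: "m = evar x" ..
    then show ?thesis
      using assms(1) lin_coef_outside[OF assms(2), of x]
      by (auto simp: lookup_sum lookup_single when_def lin_coef_def)
  next
    case False
    then have "m \<notin> Poly_Mapping.keys v"
      using assms(2) mon_degree_1D[of m] by (auto simp: sym_power_def)
    moreover have "evar x \<noteq> m" for x using False by blast
    ultimately show ?thesis
      by (auto simp: lookup_sum lookup_single when_def in_keys_iff)
  qed
qed

text \<open>Subtraction of exponents is truncated, so variables that do not divide \<alpha> have to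
  be excluded explicitly.\<close>

lemma lookup_linear_mult:
  assumes "finite X" "v \<in> sym_power X 1"
  shows "Poly_Mapping.lookup (v * Q) \<alpha> = (\<Sum>x\<in>X. if Poly_Mapping.lookup \<alpha> x = 0 then 0
           else lin_coef v x * Poly_Mapping.lookup Q (\<alpha> - evar x))"
proof -
  have summand: "Poly_Mapping.lookup (Poly_Mapping.single (evar x) (lin_coef v x) * Q) \<alpha>
      = (if Poly_Mapping.lookup \<alpha> x = 0 then 0 else lin_coef v x * Poly_Mapping.lookup Q (\<alpha> - evar x))" for x
  proof (cases "Poly_Mapping.lookup \<alpha> x = 0")
    case True
    then have "\<And>\<alpha>'. \<alpha> \<noteq> evar x + \<alpha>'" using evar_add_exists_iff[of \<alpha> x] by blast
    then show ?thesis using True by (simp add: lookup_single_mult_eq_zero)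
  next
    case False
    then obtain \<alpha>' where "\<alpha> = evar x + \<alpha>'" using evar_add_exists_iff[of \<alpha> x] by blast
    then show ?thesis using False by (simp add: lookup_single_mult)
  qed
  have "v * Q = (\<Sum>x\<in>X. Poly_Mapping.single (evar x) (lin_coef v x) * Q)"
    by (subst linear_form_eq[OF assms]) (rule sum_distrib_right)
  then show ?thesis by (simp add: lookup_sum summand)
qed

text \<open>The multinomial theorem, by induction on \<open>d\<close>: when one factor
  \<open>v\<close> is split off, each variable contributes its exponent times a common value, and
  the exponents sum to the degree.\<close>

lemma dcoef_linear_power:
  assumes X: "finite X" and v: "v \<in> sym_power X 1"
  shows "dcoef (Poly_Mapping.lookup (v ^ d)) \<alpha>
    = (if mon_degree \<alpha> = d then fact d * monom_eval (lin_coef v) \<alpha> else 0)"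
proof (induction d arbitrary: \<alpha>)
  case 0
  have "mon_degree \<alpha> = 0 \<longleftrightarrow> \<alpha> = 0"
    by (auto simp: mon_degree_def in_keys_iff intro!: poly_mapping_eqI)
  then show ?case
    by (auto simp: dcoef_def lookup_one when_def fact_prod_def monom_eval_def)
next
  case (Suc d)
  let ?P = "if mon_degree \<alpha> = Suc d then fact d * monom_eval (lin_coef v) \<alpha> else 0"
  have summand: "fact_prod \<alpha> * (lin_coef v x * Poly_Mapping.lookup (v ^ d) (\<alpha> - evar x))
      = of_nat (Poly_Mapping.lookup \<alpha> x) * ?P" if nz: "Poly_Mapping.lookup \<alpha> x \<noteq> 0" for x
  proof -
    obtain \<alpha>' where \<alpha>: "\<alpha> = evar x + \<alpha>'" using nz evar_add_exists_iff[of \<alpha> x] by blast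
    have "fact_prod \<alpha> * (lin_coef v x * Poly_Mapping.lookup (v ^ d) (\<alpha> - evar x))
        = of_nat (Poly_Mapping.lookup \<alpha> x) * (lin_coef v x * dcoef (Poly_Mapping.lookup (v ^ d)) \<alpha>')"
      unfolding \<alpha> by (simp add: fact_prod_evar_add dcoef_def)
    also have "lin_coef v x * dcoef (Poly_Mapping.lookup (v ^ d)) \<alpha>' = ?P"
      unfolding Suc.IH \<alpha> by (simp add: mon_degree_add monom_eval_add)
    finally show ?thesis .
  qed
  have "dcoef (Poly_Mapping.lookup (v ^ Suc d)) \<alpha>
      = (\<Sum>x\<in>X. of_nat (Poly_Mapping.lookup \<alpha> x) * ?P)"
    unfolding dcoef_def power_Suc lookup_linear_mult[OF X v] sum_distrib_left
  proof (rule sum.cong[OF refl])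
    fix x
    show "fact_prod \<alpha> * (if Poly_Mapping.lookup \<alpha> x = 0 then 0
          else lin_coef v x * Poly_Mapping.lookup (v ^ d) (\<alpha> - evar x))
        = of_nat (Poly_Mapping.lookup \<alpha> x) * ?P"
      by (cases "Poly_Mapping.lookup \<alpha> x = 0") (simp, simp only: summand if_False not_False_eq_True)
  qed
  also have "\<dots> = of_nat (\<Sum>x\<in>X. Poly_Mapping.lookup \<alpha> x) * ?P"
    by (simp add: sum_distrib_right)
  also have "\<dots> = (if mon_degree \<alpha> = Suc d then fact (Suc d) * monom_eval (lin_coef v) \<alpha> else 0)"
  proof (cases "Poly_Mapping.keys \<alpha> \<subseteq> X")
    case True
    then show ?thesis by (auto simp: mon_degree_superset[OF X True, symmetric])
  next
    case False
    \<comment> \<open>A monomial with a variable outside \<open>X\<close>, where \<open>v\<close>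
      has no coefficient: both sides vanish.\<close>
    then obtain y where "y \<in> Poly_Mapping.keys \<alpha>" "y \<notin> X" by blast
    then have "monom_eval (lin_coef v) \<alpha> = 0"
      unfolding monom_eval_def using lin_coef_outside[OF v] by (auto simp: in_keys_iff intro!: prod_zero bexI[of _ y])
    then show ?thesis by simp
  qed
  finally show ?case .
qed

text \<open>\<open>alt2 p q\<close> and \<open>wedge3 c p q\<close> are the coordinates of $e_p \wedge e_q$ and $c \wedge e_p \wedge e_q$.\<close>

definition alt2 :: "'x \<Rightarrow> 'x \<Rightarrow> 'x \<Rightarrow> 'x \<Rightarrow> complex" where
  "alt2 p q y z = of_bool (p = y \<and> q = z) - of_bool (p = z \<and> q = y)"

definition wedge3 :: "('x \<Rightarrow> complex) \<Rightarrow> 'x \<Rightarrow> 'x \<Rightarrow> 'x \<Rightarrow> 'x \<Rightarrow> 'x \<Rightarrow> complex" where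
  "wedge3 c p q x y z = c x * alt2 p q y z + c y * alt2 p q z x + c z * alt2 p q x y"

definition koszul_entry ::
  "('x monomial \<Rightarrow> complex) \<Rightarrow> 'x monomial \<times> 'x \<times> 'x \<Rightarrow> 'x monomial \<times> 'x \<times> 'x \<times> 'x \<Rightarrow> complex" where
  "koszul_entry a = (\<lambda>(m, p, q) (\<beta>, x, y, z). wedge3 (\<lambda>u. dcoef a (\<beta> + m + evar u)) p q x y z)"

text \<open>The numbering \<open>e\<close> stands in for a linear order on the variables, so that
  each basis bivector is listed once.\<close>

definition opairs :: "('x \<Rightarrow> nat) \<Rightarrow> 'x set \<Rightarrow> ('x \<times> 'x) set" where
  "opairs e Y = {(p, q). p \<in> Y \<and> q \<in> Y \<and> e p < e q}"

lemma finite_opairs: "finite Y \<Longrightarrow> finite (opairs e Y)"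
  by (rule finite_subset[of _ "Y \<times> Y"]) (auto simp: opairs_def)

lemma card_opairs:
  assumes "finite Y" "inj_on e Y"
  shows "card (opairs e Y) = card Y choose 2"
proof -
  have "bij_betw (\<lambda>(p, q). {p, q}) (opairs e Y) {B. B \<subseteq> Y \<and> card B = 2}"
    unfolding bij_betw_def
  proof (intro conjI)
    show "inj_on (\<lambda>(p, q). {p, q}) (opairs e Y)"
      by (auto simp: inj_on_def opairs_def doubleton_eq_iff)
    have "B \<in> (\<lambda>(p, q). {p, q}) ` opairs e Y" if B: "B \<subseteq> Y" "card B = 2" for B
    proof -
      obtain x y where xy: "B = {x, y}" "x \<noteq> y" using B by (auto simp: card_2_iff)
      then have "e x \<noteq> e y" using B assms(2) by (auto simp: inj_on_def)
      then consider "(x, y) \<in> opairs e Y" | "(y, x) \<in> opairs e Y"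
        using B xy by (auto simp: opairs_def nat_neq_iff)
      then show ?thesis
      proof cases
        case 1
        then show ?thesis by (rule rev_image_eqI) (simp add: xy)
      next
        case 2
        then show ?thesis by (rule rev_image_eqI) (simp add: xy insert_commute)
      qed
    qed
    note surj = this
    have pair: "{p, q} \<subseteq> Y \<and> card {p, q} = 2" if "(p, q) \<in> opairs e Y" for p q
    proof -
      have "p \<noteq> q" using that by (auto simp: opairs_def)
      then show ?thesis using that by (auto simp: opairs_def)
    qed
    show "(\<lambda>(p, q). {p, q}) ` opairs e Y = {B. B \<subseteq> Y \<and> card B = 2}"
    proof (intro equalityI subsetI)
      fix B assume "B \<in> (\<lambda>(p, q). {p, q}) ` opairs e Y"
      then obtain p q where "(p, q) \<in> opairs e Y" "B = {p, q}" by auto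
      then show "B \<in> {B. B \<subseteq> Y \<and> card B = 2}" using pair by simp
    qed (use surj in simp)
  qed
  from bij_betw_same_card[OF this] show ?thesis
    using n_subsets[OF assms(1), of 2] by simp
qed

text \<open>Expansion of an alternating function in the basis of bivectors: only the pair formed by
  \<open>i\<close> and \<open>j\<close> contributes, and the sign in \<open>alt2\<close> accounts
  for its order.\<close>

lemma sum_opairs_alt2:
  assumes "finite Y" "inj_on e Y" "i \<in> Y" "j \<in> Y"
    and "\<And>p q. g q p = - g p q"
  shows "(\<Sum>(p, q)\<in>opairs e Y. alt2 p q i j * g p q) = (g i j :: complex)"
proof -
  have gdiag: "g p p = 0" for p
  proof -
    have "2 * g p p = 0" using assms(5)[of p p] by (simp only: eq_neg_iff_add_eq_0 mult_2)
    then show ?thesis by simp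
  qed
  have "(\<Sum>(p, q)\<in>opairs e Y. alt2 p q i j * g p q)
      = (\<Sum>pq\<in>opairs e Y. (if pq = (i, j) then g i j else 0) - (if pq = (j, i) then g j i else 0))"
  proof (rule sum.cong[OF refl])
    fix pq assume "pq \<in> opairs e Y"
    obtain p q where "pq = (p, q)" by (cases pq)
    moreover have "of_bool (p = i \<and> q = j) * g p q = (if (p, q) = (i, j) then g i j else 0)"
      by simp
    moreover have "of_bool (p = j \<and> q = i) * g p q = (if (p, q) = (j, i) then g j i else 0)"
      by simp
    ultimately show "(case pq of (p, q) \<Rightarrow> alt2 p q i j * g p q)
        = (if pq = (i, j) then g i j else 0) - (if pq = (j, i) then g j i else 0)"
      by (simp only: alt2_def left_diff_distrib prod.case)
  qed
  also have "\<dots> = (\<Sum>pq\<in>opairs e Y. if pq = (i, j) then g i j else 0)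
      - (\<Sum>pq\<in>opairs e Y. if pq = (j, i) then g j i else 0)"
    by (rule sum_subtractf)
  also have "\<dots> = (if (i, j) \<in> opairs e Y then g i j else 0) - (if (j, i) \<in> opairs e Y then g j i else 0)"
    using finite_opairs[OF assms(1)] by simp
  also have "\<dots> = g i j"
  proof (cases "i = j")
    case True
    then show ?thesis using gdiag by (simp add: opairs_def)
  next
    case False
    then have "e i < e j \<or> e j < e i" using assms(2-4) by (meson inj_onD nat_neq_iff)
    then show ?thesis using assms(3,4) assms(5)[of i j] by (auto simp: opairs_def)
  qed
  finally show ?thesis .
qed

section \<open>Wedge products with a fixed vector\<close>

lemma alt2_swap: "alt2 q p y z = - alt2 p q y z"
  by (simp add: alt2_def conj_commute)

lemma wedge3_swap: "wedge3 c q p x y z = - wedge3 c p q x y z"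
  unfolding wedge3_def alt2_swap[of q p] by (simp add: algebra_simps)

lemma sum_alt2:
  assumes "finite X" "\<And>x. x \<notin> X \<Longrightarrow> v x = 0"
  shows "(\<Sum>p\<in>X. v p * alt2 p q y z) = v y * of_bool (q = z) - v z * of_bool (q = y)"
proof -
  have "(\<Sum>p\<in>X. v p * alt2 p q y z) = (\<Sum>p\<in>X. (if p = y then v y * of_bool (q = z) else 0)
      - (if p = z then v z * of_bool (q = y) else 0))"
  proof (rule sum.cong[OF refl])
    fix p
    have "v p * of_bool (p = y \<and> q = z) = (if p = y then v y * of_bool (q = z) else 0)" by simp
    moreover have "v p * of_bool (p = z \<and> q = y) = (if p = z then v z * of_bool (q = y) else 0)" by simp
    ultimately show "v p * alt2 p q y z = (if p = y then v y * of_bool (q = z) else 0)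
        - (if p = z then v z * of_bool (q = y) else 0)"
      by (simp only: alt2_def right_diff_distrib)
  qed
  also have "\<dots> = (\<Sum>p\<in>X. if p = y then v y * of_bool (q = z) else 0)
      - (\<Sum>p\<in>X. if p = z then v z * of_bool (q = y) else 0)"
    by (rule sum_subtractf)
  finally show ?thesis using assms by auto
qed

lemma sum_wedge3_zero:
  assumes "finite X" "\<And>x. x \<notin> X \<Longrightarrow> v x = 0"
  shows "(\<Sum>p\<in>X. v p * wedge3 v p q x y z) = 0"
proof -
  have "(\<Sum>p\<in>X. v p * wedge3 v p q x y z) = v x * (\<Sum>p\<in>X. v p * alt2 p q y z)
      + v y * (\<Sum>p\<in>X. v p * alt2 p q z x) + v z * (\<Sum>p\<in>X. v p * alt2 p q x y)"
    unfolding wedge3_def by (simp add: sum_distrib_left sum.distrib ring_distribs mult_ac)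
  also have "\<dots> = 0"
  proof -
    have eq: "(\<Sum>p\<in>X. v p * alt2 p q y z) = v y * of_bool (q = z) - v z * of_bool (q = y)" for y z
      by (rule sum_alt2) (use assms in auto)
    show ?thesis unfolding eq by (simp add: algebra_simps)
  qed
  finally show ?thesis .
qed

lemma wedge3_spanned:
  assumes X: "finite X" "inj_on e X" and v: "\<And>x. x \<notin> X \<Longrightarrow> v x = 0"
    and s: "s \<in> X" "v s \<noteq> 0" and pq: "p \<in> X" "q \<in> X"
  shows "\<exists>A. \<forall>x y z. wedge3 v p q x y z
    = (\<Sum>(i, j)\<in>opairs e (X - {s}). A (i, j) * wedge3 v i j x y z)"
proof -
  let ?Y = "X - {s}"
  have Y: "finite ?Y" "inj_on e ?Y" using X by (auto simp: inj_on_def)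
  have expand: "wedge3 v p q x y z = (\<Sum>(i, j)\<in>opairs e ?Y. alt2 i j p q * wedge3 v i j x y z)"
    if "p \<in> ?Y" "q \<in> ?Y" for p q x y z
    by (rule sum_opairs_alt2[OF Y that, symmetric]) (rule wedge3_swap)
  have solve: "wedge3 v s q x y z = (\<Sum>(i, j)\<in>opairs e ?Y.
      (\<Sum>p\<in>?Y. - (v p / v s) * alt2 i j p q) * wedge3 v i j x y z)" if q: "q \<in> ?Y" for q x y z
  proof -
    have "v s * wedge3 v s q x y z + (\<Sum>p\<in>?Y. v p * wedge3 v p q x y z) = 0"
      unfolding sum.remove[OF X(1) s(1), of "\<lambda>p. v p * wedge3 v p q x y z", symmetric]
      by (rule sum_wedge3_zero) (use X(1) v in auto)
    then have "wedge3 v s q x y z = - (\<Sum>p\<in>?Y. v p * wedge3 v p q x y z) / v s"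
      using s(2) by (simp add: field_simps eq_neg_iff_add_eq_0)
    also have "\<dots> = (\<Sum>p\<in>?Y. - (v p / v s) * wedge3 v p q x y z)"
      by (simp add: sum_divide_distrib sum_negf)
    also have "\<dots> = (\<Sum>p\<in>?Y. \<Sum>(i, j)\<in>opairs e ?Y. - (v p / v s) * alt2 i j p q * wedge3 v i j x y z)"
    proof (rule sum.cong[OF refl])
      fix p assume p: "p \<in> ?Y"
      show "- (v p / v s) * wedge3 v p q x y z
          = (\<Sum>(i, j)\<in>opairs e ?Y. - (v p / v s) * alt2 i j p q * wedge3 v i j x y z)"
        unfolding expand[OF p q] sum_distrib_left by (rule sum.cong) (auto simp: mult.assoc)
    qed
    also have "\<dots> = (\<Sum>(i, j)\<in>opairs e ?Y. (\<Sum>p\<in>?Y. - (v p / v s) * alt2 i j p q) * wedge3 v i j x y z)"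
      by (subst sum.swap) (auto simp: sum_distrib_right intro!: sum.cong)
    finally show ?thesis .
  qed
  have diag: "wedge3 v p p x y z = 0" for p x y z
    by (simp add: wedge3_def alt2_def conj_commute)
  consider "p \<in> ?Y" "q \<in> ?Y" | "p = s" "q \<in> ?Y" | "p \<in> ?Y" "q = s" | "p = s" "q = s"
    using pq by blast
  then show ?thesis
  proof cases
    case 1
    then show ?thesis
      by (intro exI[of _ "\<lambda>(i, j). alt2 i j p q"] allI) (simp add: expand)
  next
    case 2
    then show ?thesis
      by (intro exI[of _ "\<lambda>(i, j). \<Sum>p\<in>?Y. - (v p / v s) * alt2 i j p q"] allI) (simp add: solve)
  next
    case 3
    have "wedge3 v p q x y z = (\<Sum>(i, j)\<in>opairs e ?Y.
        - (\<Sum>p'\<in>?Y. - (v p' / v s) * alt2 i j p' p) * wedge3 v i j x y z)" for x y z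
      unfolding 3(2) wedge3_swap[of v p s] solve[OF 3(1)]
      by (subst sum_negf[symmetric], rule sum.cong) (simp_all only: case_prod_unfold mult_minus_left)
    then show ?thesis
      by (intro exI[of _ "\<lambda>(i, j). - (\<Sum>p'\<in>?Y. - (v p' / v s) * alt2 i j p' p)"] allI) simp
  next
    case 4
    then show ?thesis by (intro exI[of _ "\<lambda>_. 0"]) (simp add: diag)
  qed
qed

lemma koszul_entry_power_factorization:
  assumes X: "finite X" "inj_on (e :: 'x \<Rightarrow> nat) X" and v: "v \<in> sym_power X 1"
  shows "\<exists>A B. \<forall>m p q c. p \<in> X \<longrightarrow> q \<in> X \<longrightarrow> Suc (mon_degree m + mon_degree (fst c)) = d \<longrightarrow>
    koszul_entry (Poly_Mapping.lookup (v ^ d)) (m, p, q) c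
      = (\<Sum>l<(card X - 1) choose 2. A (m, p, q) l * B l c)"
proof -
  let ?v = "lin_coef v"
  have entry: "koszul_entry (Poly_Mapping.lookup (v ^ d)) (m, p, q) (\<beta>, x, y, z)
      = fact d * monom_eval ?v m * monom_eval ?v \<beta> * wedge3 ?v p q x y z"
    if "Suc (mon_degree m + mon_degree \<beta>) = d" for m p q \<beta> x y z
    using that unfolding koszul_entry_def wedge3_def dcoef_linear_power[OF X(1) v]
    by (simp add: mon_degree_add monom_eval_add algebra_simps)
  show ?thesis
  proof (cases "\<exists>s\<in>X. ?v s \<noteq> 0")
    case False
    \<comment> \<open>The zero form has no coordinate to eliminate, but all its entries vanish;
      \<open>d = 0\<close> is excluded by the degree condition.\<close>
    then have "?v x = 0" for x using lin_coef_outside[OF v] by blast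
    then have "koszul_entry (Poly_Mapping.lookup (v ^ d)) (m, p, q) c = 0"
      if "Suc (mon_degree m + mon_degree (fst c)) = d" for m p q c
      using that by (cases c) (simp add: entry wedge3_def)
    then show ?thesis by (intro exI[of _ "\<lambda>_ _. 0"]) simp
  next
    case True
    then obtain s where s: "s \<in> X" "?v s \<noteq> 0" by blast
    let ?Y = "X - {s}"
    have "card (opairs e ?Y) = (card X - 1) choose 2"
      using card_opairs[of ?Y e] X s by (auto simp: inj_on_def)
    then obtain h where h: "bij_betw h {..<(card X - 1) choose 2} (opairs e ?Y)"
      using ex_bij_betw_nat_finite[OF finite_opairs, of ?Y e] X(1) by (auto simp: atLeast0LessThan)
    have "\<exists>A. \<forall>x y z. wedge3 ?v p q x y z = (\<Sum>(i, j)\<in>opairs e ?Y. A (i, j) * wedge3 ?v i j x y z)"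
      if "p \<in> X" "q \<in> X" for p q
      by (rule wedge3_spanned) (use X s that lin_coef_outside[OF v] in auto)
    then have "\<forall>p q. \<exists>A. p \<in> X \<longrightarrow> q \<in> X \<longrightarrow> (\<forall>x y z.
        wedge3 ?v p q x y z = (\<Sum>(i, j)\<in>opairs e ?Y. A (i, j) * wedge3 ?v i j x y z))"
      by blast
    then obtain A where "\<forall>p q. p \<in> X \<longrightarrow> q \<in> X \<longrightarrow> (\<forall>x y z.
        wedge3 ?v p q x y z = (\<Sum>(i, j)\<in>opairs e ?Y. A p q (i, j) * wedge3 ?v i j x y z))"
      unfolding choice_iff by blast
    then have A: "wedge3 ?v p q x y z = (\<Sum>(i, j)\<in>opairs e ?Y. A p q (i, j) * wedge3 ?v i j x y z)"
      if "p \<in> X" "q \<in> X" for p q x y z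
      using that by blast
    let ?A = "\<lambda>(m, p, q) l. fact d * monom_eval ?v m * A p q (h l)"
    let ?B = "\<lambda>l (\<beta>, x, y, z). monom_eval ?v \<beta> * wedge3 ?v (fst (h l)) (snd (h l)) x y z"
    have "koszul_entry (Poly_Mapping.lookup (v ^ d)) (m, p, q) c
        = (\<Sum>l<(card X - 1) choose 2. ?A (m, p, q) l * ?B l c)"
      if "p \<in> X" "q \<in> X" "Suc (mon_degree m + mon_degree (fst c)) = d" for m p q c
    proof -
      obtain \<beta> x y z where c: "c = (\<beta>, x, y, z)" by (cases c)
      have "wedge3 ?v p q x y z
          = (\<Sum>l<(card X - 1) choose 2. A p q (h l) * wedge3 ?v (fst (h l)) (snd (h l)) x y z)"
        unfolding A[OF that(1,2)]
        using sum.reindex_bij_betw[OF h, of "\<lambda>(i, j). A p q (i, j) * wedge3 ?v i j x y z"]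
        by (simp add: case_prod_unfold)
      then show ?thesis
        using that(3) by (simp add: c entry sum_distrib_left mult_ac)
    qed
    then show ?thesis
      by (intro exI[of _ ?A] exI[of _ ?B] allI impI)
  qed
qed

section \<open>Minors of the flattening on forms of small rank\<close>

lemma dcoef_sum: "dcoef (\<lambda>\<alpha>. \<Sum>i\<in>I. f i \<alpha>) \<alpha> = (\<Sum>i\<in>I. dcoef (f i) \<alpha>)"
  by (simp add: dcoef_def sum_distrib_left)

lemma koszul_entry_sum:
  "koszul_entry (\<lambda>\<alpha>. \<Sum>i\<in>I. f i \<alpha>) ix c = (\<Sum>i\<in>I. koszul_entry (f i) ix c)"
  by (cases ix; cases c)
     (simp add: koszul_entry_def wedge3_def dcoef_sum sum.distrib sum_distrib_right)

lemma polynomial_fun_koszul_entry: "polynomial_fun (\<lambda>a. koszul_entry a ix c)"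
  by (cases ix; cases c)
     (auto simp: koszul_entry_def wedge3_def dcoef_def
       intro!: polynomial_fun_add polynomial_fun_mult polynomial_fun_const polynomial_fun_coord)

lemma Inf_enat_in:
  assumes "Inf (S :: enat set) \<noteq> \<infinity>"
  shows "Inf S \<in> S"
proof -
  have "S \<noteq> {}" using assms by (auto simp: Inf_enat_def)
  then obtain x where "x \<in> S" by blast
  then show ?thesis
    unfolding Inf_enat_def using \<open>S \<noteq> {}\<close> LeastI[of "\<lambda>y. y \<in> S" x] by simp
qed

text \<open>Subadditivity of rank: the factorizations of the at most \<open>r\<close> powers are
  stacked into a single one, whose inner indices are pairs of a summand and a coordinate. There are
  fewer than \<open>R\<close> of them.\<close>

lemma koszul_minor_zero:
  fixes X :: "'x set" and e :: "'x \<Rightarrow> nat"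
  assumes X: "finite X" "inj_on e X"
    and rank: "sym_rank X d Q \<le> enat r" "r * ((card X - 1) choose 2) < R"
    and rw: "\<And>i. i < R \<Longrightarrow> case rw i of (m, p, q) \<Rightarrow> p \<in> X \<and> q \<in> X \<and> mon_degree m = k"
    and cl: "\<And>j. j < R \<Longrightarrow> Suc (k + mon_degree (fst (cl j))) = d"
  shows "Determinant.det (mat R R (\<lambda>(i, j). koszul_entry (Poly_Mapping.lookup Q) (rw i) (cl j))) = 0"
proof -
  let ?C = "(card X - 1) choose 2"
  let ?S = "{enat r | r. \<exists>v. (\<forall>i<r. v i \<in> sym_power X 1) \<and> Q = (\<Sum>i<r. v i ^ d)}"
  have "sym_rank X d Q \<noteq> \<infinity>" using rank(1) by (cases "sym_rank X d Q") auto
  then have "sym_rank X d Q \<in> ?S"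
    unfolding sym_rank_def by (rule Inf_enat_in)
  then obtain r' v where r': "sym_rank X d Q = enat r'" and v: "\<And>i. i < r' \<Longrightarrow> v i \<in> sym_power X 1"
    and Q: "Q = (\<Sum>i<r'. v i ^ d)" by blast
  have "r' \<le> r" using rank(1) r' by simp
  have "\<forall>i. \<exists>A B. i < r' \<longrightarrow> (\<forall>m p q c. p \<in> X \<longrightarrow> q \<in> X \<longrightarrow> Suc (mon_degree m + mon_degree (fst c)) = d \<longrightarrow>
      koszul_entry (Poly_Mapping.lookup (v i ^ d)) (m, p, q) c = (\<Sum>l<?C. A (m, p, q) l * B l c))"
    using koszul_entry_power_factorization[OF X v] by blast
  then obtain A B where "\<forall>i. i < r' \<longrightarrow> (\<forall>m p q c. p \<in> X \<longrightarrow> q \<in> X \<longrightarrow> Suc (mon_degree m + mon_degree (fst c)) = d \<longrightarrow>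
      koszul_entry (Poly_Mapping.lookup (v i ^ d)) (m, p, q) c = (\<Sum>l<?C. A i (m, p, q) l * B i l c))"
    unfolding choice_iff by blast
  then have AB: "koszul_entry (Poly_Mapping.lookup (v i ^ d)) (m, p, q) c = (\<Sum>l<?C. A i (m, p, q) l * B i l c)"
    if "i < r'" "p \<in> X" "q \<in> X" "Suc (mon_degree m + mon_degree (fst c)) = d" for i m p q c
    using that by blast
  define A' where "A' i tl = A (fst tl) (rw i) (snd tl)" for i tl
  define B' where "B' tl j = B (fst tl) (snd tl) (cl j)" for tl j
  have factor: "koszul_entry (Poly_Mapping.lookup Q) (rw i) (cl j) = (\<Sum>tl\<in>{..<r'} \<times> {..<?C}. A' i tl * B' tl j)"
    if ij: "i < R" "j < R" for i j
  proof -
    obtain m p q where ix: "rw i = (m, p, q)" by (cases "rw i")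
    have lookup: "Poly_Mapping.lookup Q = (\<lambda>\<alpha>. \<Sum>t<r'. Poly_Mapping.lookup (v t ^ d) \<alpha>)"
      unfolding Q by (rule ext) (rule lookup_sum)
    have "koszul_entry (Poly_Mapping.lookup Q) (rw i) (cl j)
        = (\<Sum>t<r'. \<Sum>l<?C. A t (rw i) l * B t l (cl j))"
      unfolding lookup koszul_entry_sum
      by (rule sum.cong) (use ij rw[of i] cl[of j] in \<open>auto simp: ix AB\<close>)
    then show ?thesis
      by (simp add: sum.cartesian_product case_prod_unfold A'_def B'_def)
  qed
  have "card ({..<r'} \<times> {..<?C}) = r' * ?C" by simp
  also have "\<dots> < R" using rank(2) \<open>r' \<le> r\<close> by (meson le_less_trans mult_le_mono1)
  finally show ?thesis by (intro det_factorization_zero[OF _ _ factor]) auto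
qed

subsection \<open>Cocycles on strict chains\<close>

definition strict_less :: "nat \<times> nat \<Rightarrow> nat \<times> nat \<Rightarrow> bool" where
  "strict_less p q \<longleftrightarrow> fst p < fst q \<and> snd p < snd q"

definition comparable :: "nat \<times> nat \<Rightarrow> nat \<times> nat \<Rightarrow> bool" where
  "comparable p q \<longleftrightarrow> strict_less p q \<or> strict_less q p"

definition strict_chain :: "(nat \<times> nat) set \<Rightarrow> bool" where
  "strict_chain \<sigma> \<longleftrightarrow> (\<forall>p\<in>\<sigma>. \<forall>q\<in>\<sigma>. p \<noteq> q \<longrightarrow> comparable p q)"

definition chains :: "(nat \<times> nat) set \<Rightarrow> nat \<Rightarrow> (nat \<times> nat) set set" where
  "chains X k = {\<sigma>. \<sigma> \<subseteq> X \<and> card \<sigma> = k \<and> strict_chain \<sigma>}"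

section \<open>Comparability and least elements\<close>

lemma comparable_sym: "comparable p q \<longleftrightarrow> comparable q p"
  by (auto simp: comparable_def)

lemma comparable_irrefl [simp]: "\<not> comparable p p"
  by (auto simp: comparable_def strict_less_def)

lemma strict_less_asym: "strict_less p q \<Longrightarrow> \<not> strict_less q p"
  by (auto simp: strict_less_def)

lemma strict_less_irrefl [simp]: "\<not> strict_less p p"
  by (auto simp: strict_less_def)

lemma strict_chainD: "strict_chain \<sigma> \<Longrightarrow> p \<in> \<sigma> \<Longrightarrow> q \<in> \<sigma> \<Longrightarrow> p \<noteq> q \<Longrightarrow> comparable p q"
  by (auto simp: strict_chain_def)

lemma strict_chain_subset: "strict_chain \<sigma> \<Longrightarrow> \<tau> \<subseteq> \<sigma> \<Longrightarrow> strict_chain \<tau>"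
  unfolding strict_chain_def by blast

definition least_in :: "(nat \<times> nat) set \<Rightarrow> nat \<times> nat \<Rightarrow> bool" where
  "least_in \<sigma> m \<longleftrightarrow> m \<in> \<sigma> \<and> (\<forall>s\<in>\<sigma>. s \<noteq> m \<longrightarrow> strict_less m s)"

lemma strict_chain_least:
  assumes "finite \<sigma>" "\<sigma> \<noteq> {}" "strict_chain \<sigma>"
  shows "\<exists>m. least_in \<sigma> m"
proof -
  obtain m where m: "m \<in> \<sigma>" and "\<not> (\<exists>s\<in>\<sigma>. fst s < fst m)"
    using arg_min_if_finite[OF assms(1,2), of fst] by blast
  then have min: "\<not> strict_less s m" if "s \<in> \<sigma>" for s
    using that unfolding strict_less_def by blast
  have "strict_less m s" if "s \<in> \<sigma>" "s \<noteq> m" for s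
    using strict_chainD[OF assms(3) that(1) m that(2)] min[OF that(1)] by (simp add: comparable_def)
  then show ?thesis using m unfolding least_in_def by blast
qed

lemma least_in_unique:
  assumes "least_in \<sigma> m" "least_in \<sigma> m'"
  shows "m = m'"
proof (rule ccontr)
  assume "m \<noteq> m'"
  then have "strict_less m m'" "strict_less m' m" using assms by (auto simp: least_in_def)
  then show False using strict_less_asym by blast
qed

text \<open>The 1-form \<open>\<sigma> \<otimes> v\<close> has a boundary with one term \<open>(\<sigma> - {u}) \<otimes> (v \<and> u)\<close> for each \<open>u \<in> \<sigma>\<close>;
  the pivot is the term used to normalise cocycles modulo this boundary. The two preferences make
  the normalisations of different \<open>v\<close> in one multidegree independent of each other.\<close>

definition pivot_spec :: "(nat \<times> nat) set \<Rightarrow> nat \<times> nat \<Rightarrow> nat \<times> nat \<Rightarrow> bool" where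
  "pivot_spec \<sigma> v u \<longleftrightarrow> u \<in> \<sigma> \<and> u \<noteq> v
     \<and> (\<forall>m. least_in \<sigma> m \<and> strict_less m v \<longrightarrow> u = m)
     \<and> ((\<exists>s\<in>\<sigma>. comparable s v) \<longrightarrow> comparable u v)"

definition pivot :: "(nat \<times> nat) set \<Rightarrow> nat \<times> nat \<Rightarrow> nat \<times> nat" where
  "pivot \<sigma> v = (SOME u. pivot_spec \<sigma> v u)"

text \<open>The two preferences are compatible, because a least element strictly below
  \<open>v\<close> is itself comparable to \<open>v\<close>. If neither applies, the cardinality
  leaves an element other than \<open>v\<close>.\<close>

lemma pivot_spec_pivot:
  assumes "card \<sigma> \<ge> 2"
  shows "pivot_spec \<sigma> v (pivot \<sigma> v)"
proof -
  consider m where "least_in \<sigma> m" "strict_less m v"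
    | s where "\<And>m. least_in \<sigma> m \<Longrightarrow> \<not> strict_less m v" "s \<in> \<sigma>" "comparable s v"
    | "\<And>m. least_in \<sigma> m \<Longrightarrow> \<not> strict_less m v" "\<And>s. s \<in> \<sigma> \<Longrightarrow> \<not> comparable s v"
    by blast
  then have "\<exists>u. pivot_spec \<sigma> v u"
  proof cases
    case 1
    then have "m \<in> \<sigma>" "m \<noteq> v" "comparable m v"
      by (auto simp: comparable_def least_in_def)
    then have "pivot_spec \<sigma> v m"
      using least_in_unique[OF 1(1)] unfolding pivot_spec_def by blast
    then show ?thesis ..
  next
    case 2
    then have "pivot_spec \<sigma> v s" by (auto simp: pivot_spec_def)
    then show ?thesis ..
  next
    case 3
    have "\<not> \<sigma> \<subseteq> {v}"
      using assms card_mono[of "{v}" \<sigma>] by auto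
    then obtain u where "u \<in> \<sigma>" "u \<noteq> v" by blast
    then have "pivot_spec \<sigma> v u" using 3 by (auto simp: pivot_spec_def)
    then show ?thesis ..
  qed
  then show ?thesis
    unfolding pivot_def by (rule someI_ex)
qed

lemma three_distinct:
  assumes "card S \<ge> 3"
  obtains x y z where "x \<in> S" "y \<in> S" "z \<in> S" "x \<noteq> y" "x \<noteq> z" "y \<noteq> z"
proof -
  have "\<exists>T\<subseteq>S. card T = 3" using assms by (metis obtain_subset_with_card_n)
  then obtain T where "T \<subseteq> S" "card T = 3" by blast
  then obtain x y z where "T = {x, y, z}" "x \<noteq> y" "x \<noteq> z" "y \<noteq> z"
    by (auto simp: card_3_iff)
  then show ?thesis using that[of x y z] \<open>T \<subseteq> S\<close> by simp
qed

text \<open>\<open>a \<sigma> p q\<close> is the coefficient of the 2-form (monomial of the chain \<open>\<sigma>\<close>) \<open>dx\<^sub>p \<and> dx\<^sub>q\<close>, and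
  \<open>closed\<close> says that the exterior derivative vanishes on each squarefree monomial \<open>\<beta>\<close>.\<close>

locale chain_cocycle =
  fixes X :: "(nat \<times> nat) set" and k :: nat
    and a :: "(nat \<times> nat) set \<Rightarrow> nat \<times> nat \<Rightarrow> nat \<times> nat \<Rightarrow> complex"
  assumes finX: "finite X" and k: "k \<ge> 3"
    and anti: "\<And>\<sigma> p q. a \<sigma> q p = - a \<sigma> p q"
    and supp: "\<And>\<sigma> p q. a \<sigma> p q \<noteq> 0 \<Longrightarrow> \<sigma> \<in> chains X k \<and> p \<in> X \<and> q \<in> X"
    and closed: "\<And>\<beta> x y z. \<beta> \<subseteq> X \<Longrightarrow> card \<beta> = k - 1 \<Longrightarrow> x \<in> X \<Longrightarrow> y \<in> X \<Longrightarrow> z \<in> X \<Longrightarrow>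
        x \<noteq> y \<Longrightarrow> x \<noteq> z \<Longrightarrow> y \<noteq> z \<Longrightarrow>
        (if x \<in> \<beta> then 0 else a (insert x \<beta>) y z) + (if y \<in> \<beta> then 0 else a (insert y \<beta>) z x)
          + (if z \<in> \<beta> then 0 else a (insert z \<beta>) x y) = 0"
    and pivot_zero: "\<And>\<sigma> v. \<sigma> \<in> chains X (Suc k) \<Longrightarrow> v \<in> X \<Longrightarrow> \<exists>s\<in>\<sigma>. \<not> strict_less v s \<Longrightarrow>
        a (\<sigma> - {pivot \<sigma> v}) v (pivot \<sigma> v) = 0"
begin

section \<open>Vanishing of normalised cocycles, by the position of the two variables\<close>

lemma diag [simp]: "a \<sigma> p p = 0"
proof -
  have "2 * a \<sigma> p p = 0" using anti[of \<sigma> p p] by (simp only: eq_neg_iff_add_eq_0 mult_2)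
  then show ?thesis by simp
qed

lemma chainD:
  assumes "a \<sigma> p q \<noteq> 0"
  shows "\<sigma> \<subseteq> X" "finite \<sigma>" "card \<sigma> = k" "strict_chain \<sigma>" "p \<in> X" "q \<in> X" "p \<noteq> q"
proof -
  show "p \<noteq> q" using assms by auto
  show "finite \<sigma>" using supp[OF assms] finX finite_subset unfolding chains_def by blast
qed (use supp[OF assms] in \<open>auto simp: chains_def\<close>)

text \<open>Removing a third element \<open>s\<close> from \<sigma> leaves a set that still contains
  \<open>p\<close> and \<open>q\<close>, so only the term at \<open>s\<close> survives in the
  cocycle equation.\<close>

lemma zero_if_both_in:
  assumes "p \<in> \<sigma>" "q \<in> \<sigma>"
  shows "a \<sigma> p q = 0"
proof (rule ccontr)
  assume nz: "a \<sigma> p q \<noteq> 0"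
  note c = chainD[OF nz]
  obtain s where s: "s \<in> \<sigma>" "s \<noteq> p" "s \<noteq> q"
    using three_distinct[of \<sigma>] c(3) k by metis
  have "card (\<sigma> - {s}) = k - 1" using s c by simp
  from closed[OF _ this, of s p q] show False
    using nz s c assms by (auto simp: insert_absorb)
qed

text \<open>The cocycle equation carries the value unchanged to every 2-form obtained by exchanging
  \<open>q\<close> with another element of \<open>insert q \<sigma>\<close>. All their supports are
  chains, hence so is the whole set, and one of these 2-forms is the pivot term for
  \<open>p\<close>.\<close>

lemma zero_if_first_in:
  assumes "p \<in> \<sigma>" "q \<notin> \<sigma>"
  shows "a \<sigma> p q = 0"
proof (rule ccontr)
  assume nz: "a \<sigma> p q \<noteq> 0"
  note c = chainD[OF nz]
  have move: "a (insert q (\<sigma> - {s})) p s = a \<sigma> p q" if "s \<in> \<sigma>" "s \<noteq> p" for s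
  proof -
    have "card (\<sigma> - {s}) = k - 1" using that c by simp
    from closed[OF _ this, of s p q] have "a \<sigma> p q + a (insert q (\<sigma> - {s})) s p = 0"
      using that c assms by (auto simp: insert_absorb)
    then show ?thesis using anti[of "insert q (\<sigma> - {s})" s p] by simp
  qed
  \<comment> \<open>An element \<open>s\<close> other than \<open>p\<close> and \<open>e\<close> can
    be exchanged for \<open>q\<close>, giving a chain that contains both \<open>q\<close> and
    \<open>e\<close>.\<close>
  have "comparable q e" if "e \<in> \<sigma>" for e
  proof -
    obtain s where "s \<in> \<sigma>" "s \<noteq> p" "s \<noteq> e"
      using three_distinct[of \<sigma>] c(3) k by metis
    with move nz have "strict_chain (insert q (\<sigma> - {s}))" using chainD(4) by metis
    then show ?thesis
      using that \<open>s \<noteq> e\<close> assms by (intro strict_chainD[of "insert q (\<sigma> - {s})"]) auto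
  qed
  then have chain: "strict_chain (insert q \<sigma>)"
    using c(4) unfolding strict_chain_def by (auto simp: comparable_sym[of q])
  let ?S = "insert q \<sigma>" let ?u = "pivot ?S p"
  have card: "card ?S = Suc k" using c assms by simp
  then have u: "pivot_spec ?S p ?u" using k by (intro pivot_spec_pivot) simp
  \<comment> \<open>The normalisation applies because \<open>p\<close> lies in the chain and is not
    strictly below itself.\<close>
  have "\<exists>s\<in>?S. \<not> strict_less p s" using assms(1) by (intro bexI[of _ p]) auto
  then have "a (?S - {?u}) p ?u = 0"
    using chain card c by (intro pivot_zero) (auto simp: chains_def)
  moreover have "a (?S - {?u}) p ?u = a \<sigma> p q"
  proof (cases "?u = q")
    case True
    then show ?thesis using assms by simp
  next
    case False
    then have "?u \<in> \<sigma>" "?u \<noteq> p" using u by (auto simp: pivot_spec_def)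
    moreover have "?S - {?u} = insert q (\<sigma> - {?u})" using False by auto
    ultimately show ?thesis using move by simp
  qed
  ultimately show False using nz by simp
qed

text \<open>In the squarefree multidegree \<open>W\<close> the cocycle is an alternating function
  \<open>c\<close> on pairs with a triangle relation. If \<open>W\<close> is a chain, normalisation
  kills all pairs with its least element. Otherwise every pair with nonzero \<open>c\<close> meets
  every incomparable pair, since its complement is a chain.\<close>

lemma zero_if_disjoint:
  assumes "p \<notin> \<sigma>" "q \<notin> \<sigma>"
  shows "a \<sigma> p q = 0"
proof (rule ccontr)
  assume nz: "a \<sigma> p q \<noteq> 0"
  note c0 = chainD[OF nz]
  define W where "W = insert p (insert q \<sigma>)"
  have W: "W \<subseteq> X" "finite W" "card W = k + 2" "p \<in> W" "q \<in> W"
    using c0 assms by (auto simp: W_def)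
  define c where "c x y = a (W - {x, y}) x y" for x y
  have pq: "c p q \<noteq> 0" using nz assms unfolding c_def W_def
    by (metis Diff_insert2 Diff_insert_absorb c0(7) insert_iff)
  have c_anti: "c y x = - c x y" for x y
    unfolding c_def using anti[of "W - {x, y}" x y] by (simp add: insert_commute)
  have cocycle: "c y z + c z x + c x y = 0"
    if "x \<in> W" "y \<in> W" "z \<in> W" "x \<noteq> y" "x \<noteq> z" "y \<noteq> z" for x y z
  proof -
    let ?\<beta> = "W - {x, y, z}"
    have "card {x, y, z} = 3" using that(4-6) by simp
    then have "card ?\<beta> = k - 1"
      using card_Diff_subset[of "{x, y, z}" W] that(1-3) W(3) by simp
    from closed[OF _ this, of x y z] that W
    have "a (insert x ?\<beta>) y z + a (insert y ?\<beta>) z x + a (insert z ?\<beta>) x y = 0" by auto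
    moreover have "insert x ?\<beta> = W - {y, z}" "insert y ?\<beta> = W - {z, x}" "insert z ?\<beta> = W - {x, y}"
      using that by auto
    ultimately show ?thesis unfolding c_def by simp
  qed
  have cover: "strict_chain (W - {x, y})" if "c x y \<noteq> 0" for x y
    using chainD(4) that unfolding c_def by blast
  have pivot0: "c x (pivot (W - {x}) x) = 0"
    if "x \<in> W" "strict_chain (W - {x})" "\<exists>s\<in>W - {x}. \<not> strict_less x s" for x
  proof -
    have "W - {x} \<in> chains X (Suc k)" using that W by (auto simp: chains_def)
    from pivot_zero[OF this _ that(3)] have "a (W - {x} - {pivot (W - {x}) x}) x (pivot (W - {x}) x) = 0"
      using that W by blast
    then show ?thesis
      unfolding c_def Diff_insert2[of W x "{pivot (W - {x}) x}"] .
  qed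
  have pivot_ok: "pivot_spec (W - {x}) x (pivot (W - {x}) x)" if "x \<in> W" for x
    using that W k by (intro pivot_spec_pivot) simp
  show False
  proof (cases "strict_chain W")
    case True
    then obtain m where m: "least_in W m" using strict_chain_least W by blast
    \<comment> \<open>By the first preference the pivot is \<open>m\<close> for every
      \<open>x\<close>; the triangle relation then extends the vanishing to all pairs.\<close>
    have zero: "c x m = 0" if x: "x \<in> W" "x \<noteq> m" for x
    proof -
      have "least_in (W - {x}) m" "strict_less m x" using m x by (auto simp: least_in_def)
      then have "pivot (W - {x}) x = m"
        using pivot_ok[OF x(1)] unfolding pivot_spec_def by blast
      moreover have "m \<in> W - {x}" "\<not> strict_less x m"
        using \<open>strict_less m x\<close> strict_less_asym m x by (auto simp: least_in_def)
      ultimately show ?thesis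
        using pivot0[OF x(1)] True strict_chain_subset[of W "W - {x}"] by auto
    qed
    have "m \<in> W" using m by (simp add: least_in_def)
    show False
    proof (cases "p = m \<or> q = m")
      case True
      then show False using zero W pq c0(7) c_anti by (metis neg_equal_0_iff_equal)
    next
      case False
      then show False
        using cocycle[of p q m] zero[of p] zero[of q] c_anti[of m p] W pq c0(7) \<open>m \<in> W\<close> by auto
    qed
  next
    case False
    then obtain e f where ef: "e \<in> W" "f \<in> W" "e \<noteq> f" "\<not> comparable e f"
      by (auto simp: strict_chain_def)
    \<comment> \<open>Pigeonhole on three elements of \<open>\<sigma>\<close>: one of \<open>p\<close>, \<open>q\<close> lies in three pairs on which \<open>c\<close> does not vanish.\<close>
    have star: "\<exists>x y z z'. x \<in> W \<and> y \<in> W \<and> z \<in> W \<and> z' \<in> W \<and> x \<noteq> y \<and> x \<noteq> z \<and> x \<noteq> z' \<and>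
        y \<noteq> z \<and> y \<noteq> z' \<and> z \<noteq> z' \<and> c x y \<noteq> 0 \<and> c x z \<noteq> 0 \<and> c x z' \<noteq> 0"
    proof -
      have "card \<sigma> \<ge> 3" using c0 k by simp
      then obtain z1 z2 z3 where z: "z1 \<in> \<sigma>" "z2 \<in> \<sigma>" "z3 \<in> \<sigma>" "z1 \<noteq> z2" "z1 \<noteq> z3" "z2 \<noteq> z3"
        by (rule three_distinct)
      have alt: "c p z \<noteq> 0 \<or> c q z \<noteq> 0" if "z \<in> \<sigma>" for z
      proof -
        have "z \<in> W" "p \<noteq> z" "q \<noteq> z" using that assms by (auto simp: W_def)
        then have "c q z + c z p + c p q = 0" using cocycle[of p q z] W(4,5) c0(7) by blast
        then show ?thesis using c_anti[of p z] pq by auto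
      qed
      have qp: "c q p \<noteq> 0" using c_anti[of p q] pq by simp
      have P: "?thesis" if "c p z \<noteq> 0" "c p z' \<noteq> 0" "z \<noteq> z'" "z \<in> \<sigma>" "z' \<in> \<sigma>" for z z'
        by (rule exI[of _ p], rule exI[of _ q], rule exI[of _ z], rule exI[of _ z'])
           (use that pq W c0(7) assms in \<open>auto simp: W_def\<close>)
      have Q: "?thesis" if "c q z \<noteq> 0" "c q z' \<noteq> 0" "z \<noteq> z'" "z \<in> \<sigma>" "z' \<in> \<sigma>" for z z'
        by (rule exI[of _ q], rule exI[of _ p], rule exI[of _ z], rule exI[of _ z'])
           (use that qp W c0(7) assms in \<open>auto simp: W_def\<close>)
      consider z z' where "c p z \<noteq> 0" "c p z' \<noteq> 0" "z \<noteq> z'" "z \<in> \<sigma>" "z' \<in> \<sigma>"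
        | z z' where "c q z \<noteq> 0" "c q z' \<noteq> 0" "z \<noteq> z'" "z \<in> \<sigma>" "z' \<in> \<sigma>"
        using alt[OF z(1)] alt[OF z(2)] alt[OF z(3)] z by blast
      then show ?thesis by cases (fact P, fact Q)
    qed
    then obtain x y z z' where x: "x \<in> W" and yz: "y \<in> W" "z \<in> W" "z' \<in> W"
      and dist: "x \<noteq> y" "x \<noteq> z" "x \<noteq> z'" "y \<noteq> z" "y \<noteq> z'" "z \<noteq> z'"
      and nzs: "c x y \<noteq> 0" "c x z \<noteq> 0" "c x z' \<noteq> 0"
      by blast
    \<comment> \<open>Two elements other than \<open>x\<close> both avoid one of \<open>y\<close>,
      \<open>z\<close>, \<open>z'\<close>, and the complement of \<open>x\<close> and that one is a
      chain containing them.\<close>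
    have chain_x: "strict_chain (W - {x})"
      unfolding strict_chain_def
    proof (intro ballI impI)
      fix s t assume st: "s \<in> W - {x}" "t \<in> W - {x}" "s \<noteq> t"
      then consider "s \<noteq> y" "t \<noteq> y" | "s \<noteq> z" "t \<noteq> z" | "s \<noteq> z'" "t \<noteq> z'"
        using dist by metis
      then show "comparable s t"
        using cover[OF nzs(1)] cover[OF nzs(2)] cover[OF nzs(3)] st
        by cases (auto simp: strict_chain_def)
    qed
    have "e = x \<or> f = x" using chain_x ef by (auto simp: strict_chain_def)
    then obtain w0 where w0: "w0 \<in> W" "w0 \<noteq> x" "\<not> comparable w0 x"
      using ef comparable_sym by metis
    define u where "u = pivot (W - {x}) x"
    have u: "pivot_spec (W - {x}) x u" unfolding u_def by (rule pivot_ok[OF x])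
    then have uW: "u \<in> W" "u \<noteq> x" by (auto simp: pivot_spec_def)
    have "\<exists>s\<in>W - {x}. \<not> strict_less x s" using w0 by (auto simp: comparable_def)
    then have cxu: "c x u = 0" unfolding u_def by (rule pivot0[OF x chain_x])
    \<comment> \<open>\<open>w\<close> is to be incomparable to \<open>x\<close> and different from
      the pivot. If some element is comparable to \<open>x\<close>, then so is the pivot by the
      second preference, and \<open>w0\<close> serves; otherwise \<open>y\<close> or
      \<open>z\<close> does.\<close>
    obtain w where w: "w \<in> W" "w \<noteq> x" "\<not> comparable w x" "w \<noteq> u"
    proof (cases "\<exists>s\<in>W - {x}. comparable s x")
      case True
      then have "comparable u x" using u by (auto simp: pivot_spec_def)
      then show ?thesis using that[of w0] w0 by auto
    next
      case False
      have "\<exists>w\<in>{y, z}. w \<noteq> u" using dist by auto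
      then show ?thesis using that False yz dist by blast
    qed
    \<comment> \<open>Otherwise the incomparable elements \<open>w\<close> and \<open>x\<close>
      would lie in the chain \<open>W - {s, t}\<close>.\<close>
    have vanish: "c s t = 0" if "s \<noteq> w" "t \<noteq> w" "s \<noteq> x" "t \<noteq> x" for s t
    proof (rule ccontr)
      assume "c s t \<noteq> 0"
      from cover[OF this] show False using that w x by (auto simp: strict_chain_def)
    qed
    \<comment> \<open>The triangle relation with the pivot leaves \<open>w\<close> as the only place
      where \<open>c x\<close> can be nonzero, against the two values at \<open>y\<close> and
      \<open>z\<close>.\<close>
    have "c x s = 0" if s: "s \<in> W" "s \<noteq> x" "s \<noteq> w" for s
    proof (cases "s = u")
      case False
      then show ?thesis
        using cocycle[of x s u] vanish[of s u] cxu c_anti[of x u] s x uW w by auto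
    qed (simp add: cxu)
    then have "y = w" "z = w" using nzs yz dist by metis+
    then show False using dist by simp
  qed
qed

theorem cocycle_zero: "a \<sigma> p q = 0"
proof -
  consider "p \<in> \<sigma>" "q \<in> \<sigma>" | "p \<in> \<sigma>" "q \<notin> \<sigma>" | "p \<notin> \<sigma>" "q \<in> \<sigma>" | "p \<notin> \<sigma>" "q \<notin> \<sigma>"
    by blast
  then show ?thesis
  proof cases
    case 1
    then show ?thesis by (rule zero_if_both_in)
  next
    case 2
    then show ?thesis by (rule zero_if_first_in)
  next
    case 3
    then show ?thesis using anti[of \<sigma> p q] zero_if_first_in[of q \<sigma> p] by simp
  next
    case 4
    then show ?thesis by (rule zero_if_disjoint)
  qed
qed

end

subsection \<open>Coefficients of the determinant\<close>

definition set_mon :: "'x set \<Rightarrow> 'x monomial" where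
  "set_mon A = (\<Sum>x\<in>A. evar x)"

lemma lookup_set_mon: "finite A \<Longrightarrow> Poly_Mapping.lookup (set_mon A) x = (if x \<in> A then 1 else 0)"
  by (simp add: set_mon_def lookup_sum lookup_single when_def)

lemma set_mon_inject: "finite A \<Longrightarrow> finite B \<Longrightarrow> set_mon A = set_mon B \<Longrightarrow> A = B"
  by (metis lookup_set_mon one_neq_zero subsetI subset_antisym)

lemma set_mon_union: "finite A \<Longrightarrow> finite B \<Longrightarrow> A \<inter> B = {} \<Longrightarrow> set_mon (A \<union> B) = set_mon A + set_mon B"
  unfolding set_mon_def by (rule sum.union_disjoint)

lemma set_mon_insert: "finite A \<Longrightarrow> x \<notin> A \<Longrightarrow> set_mon (insert x A) = evar x + set_mon A"
  unfolding set_mon_def by (rule sum.insert)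

lemma mon_degree_set_mon: "finite A \<Longrightarrow> mon_degree (set_mon A) = card A"
  by (subst mon_degree_superset[of A]) (auto simp: lookup_set_mon in_keys_iff split: if_splits)

text \<open>A permutation as a set of positions, that is, the support of a monomial of the
  determinant; such a set can be split into a chain and a complement.\<close>

definition perm_graph :: "nat \<Rightarrow> (nat \<times> nat) set \<Rightarrow> bool" where
  "perm_graph n G \<longleftrightarrow> bij_betw fst G {..<n} \<and> bij_betw snd G {..<n}"

lemma perm_graph_finite: "perm_graph n G \<Longrightarrow> finite G"
  unfolding perm_graph_def by (metis bij_betw_finite finite_lessThan)

lemma permutes_imp_perm_graph:
  assumes "p permutes {0..<n}"
  shows "perm_graph n ((\<lambda>i. (i, p i)) ` {0..<n})"
  unfolding perm_graph_def bij_betw_def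
  using permutes_inj_on[OF assms] permutes_image[OF assms]
  by (auto simp: inj_on_def image_image atLeast0LessThan)

lemma perm_graph_imp_permutes:
  assumes "perm_graph n G"
  shows "\<exists>p. p permutes {0..<n} \<and> G = (\<lambda>i. (i, p i)) ` {0..<n}"
proof -
  have f: "bij_betw fst G {..<n}" and s: "bij_betw snd G {..<n}"
    using assms by (auto simp: perm_graph_def)
  define h where "h = inv_into G fst"
  have h: "bij_betw h {..<n} G" unfolding h_def by (rule bij_betw_inv_into[OF f])
  have fh: "fst (h i) = i" if "i < n" for i
    unfolding h_def by (rule bij_betw_inv_into_right[OF f]) (use that in simp)
  define p where "p i = (if i < n then snd (h i) else i)" for i
  have "bij_betw (snd \<circ> h) {..<n} {..<n}" by (rule bij_betw_trans[OF h s])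
  then have "bij_betw p {0..<n} {0..<n}"
    by (subst bij_betw_cong[of _ _ "snd \<circ> h"]) (auto simp: p_def atLeast0LessThan)
  then have "p permutes {0..<n}"
    by (rule bij_imp_permutes) (simp add: p_def)
  moreover have "G = h ` {0..<n}" using h by (auto simp: bij_betw_def atLeast0LessThan)
  moreover have "h ` {0..<n} = (\<lambda>i. (i, p i)) ` {0..<n}"
  proof (rule image_cong[OF refl])
    fix i assume "i \<in> {0..<n}"
    then have "fst (h i) = i" "snd (h i) = p i" using fh by (auto simp: p_def)
    then show "h i = (i, p i)" by (metis prod.collapse)
  qed
  ultimately show ?thesis by blast
qed

section \<open>The Leibniz expansion\<close>

lemma prod_cvar: "(\<Prod>i\<in>I. cvar (f i)) = Poly_Mapping.single (\<Sum>i\<in>I. evar (f i)) 1"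
  by (induction I rule: infinite_finite_induct) (auto simp: cvar_def mult_single)

lemma lookup_det_poly:
  "Poly_Mapping.lookup (det_poly n) \<alpha> = (\<Sum>p | p permutes {0..<n}.
     if set_mon ((\<lambda>i. (i, p i)) ` {0..<n}) = \<alpha> then signof p else 0)"
proof -
  have "det_poly n = (\<Sum>p | p permutes {0..<n}. signof p * (\<Prod>i=0..<n. cvar (i, p i)))"
    unfolding det_poly_def by (subst det_def'[of _ n]) (auto intro!: sum.cong prod.cong simp: permutes_in_image)
  also have "\<dots> = (\<Sum>p | p permutes {0..<n}.
      Poly_Mapping.single (set_mon ((\<lambda>i. (i, p i)) ` {0..<n})) (signof p))"
  proof (rule sum.cong[OF refl])
    fix p :: "nat \<Rightarrow> nat"
    have "(\<Prod>i=0..<n. cvar (i, p i)) = Poly_Mapping.single (set_mon ((\<lambda>i. (i, p i)) ` {0..<n})) 1"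
      unfolding prod_cvar set_mon_def by (subst sum.reindex) (auto simp: inj_on_def)
    then show "signof p * (\<Prod>i=0..<n. cvar (i, p i))
        = Poly_Mapping.single (set_mon ((\<lambda>i. (i, p i)) ` {0..<n})) (signof p)"
      by (cases "sign p = 1") (auto simp: sign_def single_uminus)
  qed
  finally show ?thesis by (simp add: lookup_sum lookup_single when_def)
qed

lemma lookup_det_poly_nonzero:
  assumes "Poly_Mapping.lookup (det_poly n) \<alpha> \<noteq> 0"
  shows "\<exists>G. perm_graph n G \<and> \<alpha> = set_mon G"
proof -
  obtain p where "p permutes {0..<n}" "set_mon ((\<lambda>i. (i, p i)) ` {0..<n}) = \<alpha>"
    using assms unfolding lookup_det_poly
    by (rule sum.not_neutral_contains_not_neutral) (auto split: if_splits)
  then show ?thesis using permutes_imp_perm_graph by blast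
qed

text \<open>Distinct permutations have distinct graphs, so exactly one Leibniz term contributes and
  nothing cancels.\<close>

lemma lookup_det_poly_perm_graph:
  assumes "perm_graph n G"
  shows "Poly_Mapping.lookup (det_poly n) (set_mon G) \<noteq> 0"
proof -
  obtain p where p: "p permutes {0..<n}" "G = (\<lambda>i. (i, p i)) ` {0..<n}"
    using perm_graph_imp_permutes[OF assms] by blast
  have "set_mon ((\<lambda>i. (i, q i)) ` {0..<n}) = set_mon G \<longleftrightarrow> q = p" if q: "q permutes {0..<n}" for q
  proof
    assume "set_mon ((\<lambda>i. (i, q i)) ` {0..<n}) = set_mon G"
    then have eq: "(\<lambda>i. (i, q i)) ` {0..<n} = (\<lambda>i. (i, p i)) ` {0..<n}"
      unfolding p(2) by (intro set_mon_inject) auto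
    show "q = p"
    proof
      fix i show "q i = p i"
      proof (cases "i \<in> {0..<n}")
        case True
        then have "(i, q i) \<in> (\<lambda>i. (i, p i)) ` {0..<n}" unfolding eq[symmetric] by blast
        then show ?thesis by blast
      next
        case False
        then show ?thesis using p(1) q by (simp add: permutes_not_in)
      qed
    qed
  qed (simp add: p)
  then have "Poly_Mapping.lookup (det_poly n) (set_mon G)
      = (\<Sum>q | q permutes {0..<n}. if q = p then signof p else 0)"
    unfolding lookup_det_poly by (intro sum.cong) auto
  also have "\<dots> = signof p" using p(1) by (simp add: finite_permutations)
  finally show ?thesis by (simp add: sign_def)
qed

lemma fact_prod_nonzero: "fact_prod \<alpha> \<noteq> 0"
  by (simp add: fact_prod_def)

subsection \<open>Strict chains are the leading monomials of minors\<close>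

definition weight :: "(nat \<times> nat) set \<Rightarrow> nat" where
  "weight A = (\<Sum>p\<in>A. fst p * snd p)"

text \<open>For a strict chain \<sigma> these \<beta> are the supports of the monomials in the minor
  with the rows and columns of \<sigma>; \<sigma> itself is the diagonal one.\<close>

definition same_shadow :: "(nat \<times> nat) set \<Rightarrow> (nat \<times> nat) set \<Rightarrow> bool" where
  "same_shadow \<beta> \<sigma> \<longleftrightarrow> inj_on fst \<beta> \<and> inj_on snd \<beta> \<and> fst ` \<beta> = fst ` \<sigma> \<and> snd ` \<beta> = snd ` \<sigma>"

lemma strict_chain_inj:
  assumes "strict_chain \<sigma>"
  shows "inj_on fst \<sigma>" "inj_on snd \<sigma>"
proof -
  have "fst p \<noteq> fst q \<and> snd p \<noteq> snd q" if "p \<in> \<sigma>" "q \<in> \<sigma>" "p \<noteq> q" for p q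
    using strict_chainD[OF assms that] by (auto simp: comparable_def strict_less_def)
  then show "inj_on fst \<sigma>" "inj_on snd \<sigma>" unfolding inj_on_def by blast+
qed

text \<open>Exchanging the entries of the two pairs that contain the largest coordinates increases the weight.\<close>

lemma weight_less_chain:
  assumes "finite \<sigma>" "strict_chain \<sigma>" "same_shadow \<beta> \<sigma>" "\<beta> \<noteq> \<sigma>"
  shows "weight \<beta> < weight \<sigma>"
  using assms
proof (induction "card \<sigma>" arbitrary: \<sigma> \<beta>)
  case 0
  then show ?case by (auto simp: same_shadow_def)
next
  case (Suc c)
  note \<sigma> = Suc.prems(1,2)
  have inj: "inj_on fst \<beta>" "inj_on snd \<beta>" and img: "fst ` \<beta> = fst ` \<sigma>" "snd ` \<beta> = snd ` \<sigma>"
    using Suc.prems(3) by (auto simp: same_shadow_def)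
  have fin: "finite \<beta>" using inj(1) img(1) \<sigma>(1) by (metis finite_imageD finite_imageI)
  have "\<sigma> \<noteq> {}" using Suc.hyps(2) by auto
  have "Max (fst ` \<sigma>) \<in> fst ` \<sigma>" using \<sigma>(1) \<open>\<sigma> \<noteq> {}\<close> by (intro Max_in) auto
  then obtain t where t: "t \<in> \<sigma>" and "fst t = Max (fst ` \<sigma>)" by (metis imageE)
  then have tmax: "fst s \<le> fst t" if "s \<in> \<sigma>" for s using that \<sigma>(1) by simp
  have top: "strict_less s t" if "s \<in> \<sigma>" "s \<noteq> t" for s
    using strict_chainD[OF \<sigma>(2) that(1) t that(2)] tmax[OF that(1)] by (auto simp: comparable_def strict_less_def)
  let ?\<sigma> = "\<sigma> - {t}"
  have fst_del: "fst ` ?\<sigma> = fst ` \<sigma> - {fst t}" and snd_del: "snd ` ?\<sigma> = snd ` \<sigma> - {snd t}"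
    using inj_on_image_set_diff[OF strict_chain_inj(1)[OF \<sigma>(2)], of \<sigma> "{t}"]
      inj_on_image_set_diff[OF strict_chain_inj(2)[OF \<sigma>(2)], of \<sigma> "{t}"] t by auto
  have IH: "weight \<beta>' \<le> weight ?\<sigma>" "weight \<beta>' = weight ?\<sigma> \<Longrightarrow> \<beta>' = ?\<sigma>"
    if "same_shadow \<beta>' ?\<sigma>" for \<beta>'
  proof -
    have "c = card ?\<sigma>" using Suc.hyps(2) t \<sigma>(1) by simp
    moreover have "strict_chain ?\<sigma>" using \<sigma>(2) by (rule strict_chain_subset) auto
    ultimately have "\<beta>' = ?\<sigma> \<or> weight \<beta>' < weight ?\<sigma>"
      using Suc.hyps(1)[of ?\<sigma> \<beta>'] \<sigma>(1) that by auto
    then show "weight \<beta>' \<le> weight ?\<sigma>" "weight \<beta>' = weight ?\<sigma> \<Longrightarrow> \<beta>' = ?\<sigma>" by auto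
  qed
  have w\<sigma>: "weight \<sigma> = fst t * snd t + weight ?\<sigma>"
    unfolding weight_def by (rule sum.remove[OF \<sigma>(1) t])
  \<comment> \<open>\<open>l\<close> and \<open>r\<close> are the elements of \<beta> in the last
    row and the last column of \<sigma>; if they coincide, they equal \<open>t\<close>.\<close>
  obtain l where l: "l \<in> \<beta>" "fst l = fst t" using img(1) t by (metis image_iff)
  obtain r where r: "r \<in> \<beta>" "snd r = snd t" using img(2) t by (metis image_iff)
  show ?case
  proof (cases "l = r")
    case True
    then have "t \<in> \<beta>" using l r by (metis prod_eq_iff)
    let ?\<beta> = "\<beta> - {t}"
    have "same_shadow ?\<beta> ?\<sigma>"
      unfolding same_shadow_def fst_del snd_del
      using inj img \<open>t \<in> \<beta>\<close> by (simp add: inj_on_diff inj_on_image_set_diff[of _ \<beta>])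
    moreover have "?\<beta> \<noteq> ?\<sigma>" using Suc.prems(4) \<open>t \<in> \<beta>\<close> t by blast
    moreover have "weight \<beta> = fst t * snd t + weight ?\<beta>"
      unfolding weight_def by (rule sum.remove[OF fin \<open>t \<in> \<beta>\<close>])
    ultimately show ?thesis using IH[of ?\<beta>] w\<sigma> by fastforce
  next
    case False
    define \<gamma> where "\<gamma> = \<beta> - {l, r}"
    have \<beta>: "\<beta> = insert l (insert r \<gamma>)" "l \<notin> \<gamma>" "r \<notin> \<gamma>" "finite \<gamma>"
      using l r fin by (auto simp: \<gamma>_def)
    \<comment> \<open>The exchange replaces \<open>l\<close> and \<open>r\<close> by
      \<open>t\<close> and \<open>u\<close>; without \<open>t\<close> this is
      \<open>insert u \<gamma>\<close>, to which the induction hypothesis applies.\<close>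
    define u where "u = (fst r, snd l)"
    have ne: "fst r \<noteq> fst l" "snd r \<noteq> snd l"
      using inj_onD[OF inj(1) _ r(1) l(1)] inj_onD[OF inj(2) _ r(1) l(1)] False by blast+
    have "fst r \<in> fst ` ?\<sigma>"
      unfolding fst_del img(1)[symmetric] using r(1) ne(1) l(2) by simp
    then obtain s where "s \<in> ?\<sigma>" "fst r = fst s" by (rule imageE)
    then have "fst r < fst t" using top[of s] by (simp add: strict_less_def)
    have "snd l \<in> snd ` ?\<sigma>"
      unfolding snd_del img(2)[symmetric] using l(1) ne(2) r(2) by simp
    then obtain s where "s \<in> ?\<sigma>" "snd l = snd s" by (rule imageE)
    then have "snd l < snd t" using top[of s] by (simp add: strict_less_def)
    have fst\<gamma>: "fst l \<notin> fst ` \<gamma>" "fst r \<notin> fst ` \<gamma>" and snd\<gamma>: "snd l \<notin> snd ` \<gamma>" "snd r \<notin> snd ` \<gamma>"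
      using inj_onD[OF inj(1) _ l(1)] inj_onD[OF inj(1) _ r(1)]
        inj_onD[OF inj(2) _ l(1)] inj_onD[OF inj(2) _ r(1)]
      unfolding \<gamma>_def by blast+
    have "u \<notin> \<gamma>" using fst\<gamma>(2) imageI[of u \<gamma> fst] by (auto simp: u_def)
    let ?\<beta> = "insert u \<gamma>"
    have "same_shadow ?\<beta> ?\<sigma>"
      unfolding same_shadow_def fst_del snd_del
    proof (intro conjI)
      show "inj_on fst ?\<beta>" "inj_on snd ?\<beta>"
        using inj fst\<gamma> snd\<gamma> by (auto simp: \<beta>(1) u_def)
      show "fst ` ?\<beta> = fst ` \<sigma> - {fst t}"
        unfolding img(1)[symmetric] \<beta>(1) using fst\<gamma> ne l(2) by (simp add: u_def insert_Diff_if)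
      show "snd ` ?\<beta> = snd ` \<sigma> - {snd t}"
        unfolding img(2)[symmetric] \<beta>(1) using snd\<gamma> ne r(2) by (simp add: u_def insert_Diff_if)
    qed
    then have "weight ?\<beta> \<le> weight ?\<sigma>" by (rule IH(1))
    moreover have "weight ?\<beta> = fst r * snd l + weight \<gamma>"
      using \<open>u \<notin> \<gamma>\<close> \<beta>(4) by (simp add: weight_def u_def)
    moreover have "weight \<beta> = fst t * snd l + fst r * snd t + weight \<gamma>"
      unfolding \<beta>(1) using \<beta>(2-4) False l(2) r(2) by (simp add: weight_def)
    \<comment> \<open>With gaps \<open>Suc a\<close> and \<open>Suc b\<close> in the two
      coordinates, the sides differ by \<open>Suc a * Suc b\<close>.\<close>
    moreover have "fst t * snd l + fst r * snd t < fst t * snd t + fst r * snd l"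
    proof -
      obtain a where a: "fst t = fst r + Suc a" using \<open>fst r < fst t\<close> less_iff_Suc_add by auto
      obtain b where b: "snd t = snd l + Suc b" using \<open>snd l < snd t\<close> less_iff_Suc_add by auto
      show ?thesis unfolding a b by (simp add: algebra_simps)
    qed
    ultimately show ?thesis using w\<sigma> by linarith
  qed
qed

text \<open>Any bijection from the free rows to the free columns works. Differentiating the
  determinant by the variables of \<mu> gives, up to sign, the minor with the rows and columns of
  \<sigma>.\<close>

lemma exists_complement:
  assumes "\<sigma> \<subseteq> mat_vars n" "strict_chain \<sigma>"
  shows "\<exists>\<mu>. \<sigma> \<inter> \<mu> = {} \<and> perm_graph n (\<sigma> \<union> \<mu>) \<and> finite \<mu> \<and> card \<mu> = n - card \<sigma>"
proof -
  have fin: "finite \<sigma>" using assms(1) by (rule finite_subset) (simp add: mat_vars_def)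
  note inj = strict_chain_inj[OF assms(2)]
  let ?I = "{..<n} - fst ` \<sigma>" and ?K = "{..<n} - snd ` \<sigma>"
  have sub: "fst ` \<sigma> \<subseteq> {..<n}" "snd ` \<sigma> \<subseteq> {..<n}" using assms(1) by (auto simp: mat_vars_def)
  have card: "card ?I = n - card \<sigma>" "card ?K = n - card \<sigma>"
    using sub fin inj by (simp_all add: card_Diff_subset card_image)
  then obtain h where h: "bij_betw h ?I ?K"
    using finite_same_card_bij[of ?I ?K] by auto
  define \<mu> where "\<mu> = (\<lambda>i. (i, h i)) ` ?I"
  have fst\<mu>: "bij_betw fst \<mu> ?I" unfolding \<mu>_def bij_betw_def by (auto simp: inj_on_def image_image)
  have snd\<mu>: "bij_betw snd \<mu> ?K"
    using h unfolding \<mu>_def bij_betw_def by (auto simp: inj_on_def image_image)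
  have un: "fst ` \<sigma> \<union> ?I = {..<n}" "snd ` \<sigma> \<union> ?K = {..<n}" using sub by auto
  have "bij_betw fst (\<sigma> \<union> \<mu>) (fst ` \<sigma> \<union> ?I)"
    by (rule bij_betw_combine) (use fst\<mu> inj in \<open>auto simp: bij_betw_def\<close>)
  moreover have "bij_betw snd (\<sigma> \<union> \<mu>) (snd ` \<sigma> \<union> ?K)"
    by (rule bij_betw_combine) (use snd\<mu> inj in \<open>auto simp: bij_betw_def\<close>)
  ultimately have "perm_graph n (\<sigma> \<union> \<mu>)" unfolding perm_graph_def un by blast
  moreover have "\<sigma> \<inter> \<mu> = {}" by (force simp: \<mu>_def)
  moreover have "card \<mu> = n - card \<sigma>" using bij_betw_same_card[OF fst\<mu>] card by simp
  moreover have "finite \<mu>" by (simp add: \<mu>_def)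
  ultimately show ?thesis by blast
qed

text \<open>A nonzero coefficient makes \<open>insert x \<beta>\<close> the support of a monomial in
  the minor that \<mu> cuts out, and among these \<sigma> alone has the largest weight.\<close>

lemma det_coef_leading:
  assumes "strict_chain \<sigma>" "\<sigma> \<inter> \<mu> = {}" "perm_graph n (\<sigma> \<union> \<mu>)" "finite \<beta>"
    and nz: "dcoef (Poly_Mapping.lookup (det_poly n)) (set_mon \<beta> + set_mon \<mu> + evar x) \<noteq> 0"
  shows "x \<notin> \<beta>" "insert x \<beta> = \<sigma> \<or> weight (insert x \<beta>) < weight \<sigma>"
proof -
  obtain G where G: "perm_graph n G" "set_mon \<beta> + set_mon \<mu> + evar x = set_mon G"
    using nz lookup_det_poly_nonzero unfolding dcoef_def by fastforce
  have fin: "finite G" "finite \<mu>" "finite \<sigma>" using perm_graph_finite G(1) assms(3) by auto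
  \<comment> \<open>The monomial of \<open>G\<close> is squarefree, so comparing exponents makes
    \<beta>, \<mu> and \<open>{x}\<close> disjoint with union \<open>G\<close>.\<close>
  have eq: "(if y \<in> \<beta> then 1 else 0) + (if y \<in> \<mu> then 1 else 0) + (if y = x then 1 else 0)
      = (if y \<in> G then 1 else (0 :: nat))" for y
    using arg_cong[OF G(2), of "\<lambda>m. Poly_Mapping.lookup m y"] fin \<open>finite \<beta>\<close>
    by (simp add: lookup_add lookup_set_mon lookup_single when_def eq_commute)
  show x: "x \<notin> \<beta>" using eq[of x] by (auto split: if_splits)
  have "y \<in> insert x \<beta> \<longleftrightarrow> y \<in> G - \<mu>" for y using eq[of y] by (auto split: if_splits)
  then have ins: "insert x \<beta> = G - \<mu>" by blast
  have sub: "\<mu> \<subseteq> G"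
  proof
    fix y assume "y \<in> \<mu>"
    then show "y \<in> G" using eq[of y] by (auto split: if_splits)
  qed
  have \<sigma>: "\<sigma> = (\<sigma> \<union> \<mu>) - \<mu>" using assms(2) by blast
  have shadow: "f ` (G - \<mu>) = f ` \<sigma>" if "bij_betw f G {..<n}" "bij_betw f (\<sigma> \<union> \<mu>) {..<n}"
    for f :: "nat \<times> nat \<Rightarrow> nat"
  proof -
    have "f ` (G - \<mu>) = {..<n} - f ` \<mu>"
      using that(1) sub by (metis Diff_subset bij_betw_def inj_on_image_set_diff)
    also have "\<dots> = f ` ((\<sigma> \<union> \<mu>) - \<mu>)"
      using that(2) by (metis Diff_subset Un_upper2 bij_betw_def inj_on_image_set_diff)
    finally show ?thesis using \<sigma> by simp
  qed
  have "same_shadow (G - \<mu>) \<sigma>"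
    unfolding same_shadow_def
    using G(1) assms(3) shadow unfolding perm_graph_def
    by (auto simp: bij_betw_def intro: inj_on_diff)
  then show "insert x \<beta> = \<sigma> \<or> weight (insert x \<beta>) < weight \<sigma>"
    unfolding ins using weight_less_chain[OF fin(3) assms(1)] by blast
qed

lemma det_coef_chain:
  assumes "\<sigma> \<inter> \<mu> = {}" "perm_graph n (\<sigma> \<union> \<mu>)"
  shows "dcoef (Poly_Mapping.lookup (det_poly n)) (set_mon \<sigma> + set_mon \<mu>) \<noteq> 0"
proof -
  have "finite \<sigma>" "finite \<mu>" using perm_graph_finite[OF assms(2)] by auto
  then have "set_mon \<sigma> + set_mon \<mu> = set_mon (\<sigma> \<union> \<mu>)" using assms(1) by (simp add: set_mon_union)
  then show ?thesis
    using lookup_det_poly_perm_graph[OF assms(2)] fact_prod_nonzero by (simp add: dcoef_def)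
qed

subsection \<open>Independent rows of the flattening of the determinant\<close>

definition complement_of :: "nat \<Rightarrow> (nat \<times> nat) set \<Rightarrow> (nat \<times> nat) set" where
  "complement_of n \<sigma> =
     (SOME \<mu>. \<sigma> \<inter> \<mu> = {} \<and> perm_graph n (\<sigma> \<union> \<mu>) \<and> finite \<mu> \<and> card \<mu> = n - card \<sigma>)"

lemma complement_of:
  assumes "\<sigma> \<in> chains (mat_vars n) k"
  shows "\<sigma> \<inter> complement_of n \<sigma> = {}" "perm_graph n (\<sigma> \<union> complement_of n \<sigma>)"
    "finite (complement_of n \<sigma>)" "card (complement_of n \<sigma>) = n - k"
proof -
  have "\<exists>\<mu>. \<sigma> \<inter> \<mu> = {} \<and> perm_graph n (\<sigma> \<union> \<mu>) \<and> finite \<mu> \<and> card \<mu> = n - card \<sigma>"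
    using assms by (intro exists_complement) (auto simp: chains_def)
  from someI_ex[OF this]
  show "\<sigma> \<inter> complement_of n \<sigma> = {}" "perm_graph n (\<sigma> \<union> complement_of n \<sigma>)"
    "finite (complement_of n \<sigma>)" "card (complement_of n \<sigma>) = n - k"
    using assms unfolding complement_of_def[symmetric] by (auto simp: chains_def)
qed

lemma finite_chains: "finite X \<Longrightarrow> finite (chains X k)"
  by (rule finite_subset[of _ "Pow X"]) (auto simp: chains_def)

lemma finite_mat_vars [simp]: "finite (mat_vars n)"
  by (simp add: mat_vars_def)

definition wedge_basis ::
  "((nat \<times> nat) \<Rightarrow> nat) \<Rightarrow> nat \<Rightarrow> nat \<Rightarrow> ((nat \<times> nat) set \<times> (nat \<times> nat) \<times> (nat \<times> nat)) set" where
  "wedge_basis e n k = chains (mat_vars n) k \<times> opairs e (mat_vars n)"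

text \<open>The 1-forms used for normalising. Pairs with \<open>v\<close> below the whole chain are
  left out; they correspond to chains of size \<open>k + 2\<close> and produce the last term of the
  count.\<close>

definition pivot_pairs :: "nat \<Rightarrow> nat \<Rightarrow> ((nat \<times> nat) set \<times> (nat \<times> nat)) set" where
  "pivot_pairs n k = {(\<sigma>, v). \<sigma> \<in> chains (mat_vars n) (Suc k) \<and> v \<in> mat_vars n \<and> (\<exists>s\<in>\<sigma>. \<not> strict_less v s)}"

text \<open>The indices of the pivot terms, with the two variables sorted by \<open>e\<close> as in
  \<open>wedge_basis\<close>.\<close>

definition pivot_rows ::
  "((nat \<times> nat) \<Rightarrow> nat) \<Rightarrow> nat \<Rightarrow> nat \<Rightarrow> ((nat \<times> nat) set \<times> (nat \<times> nat) \<times> (nat \<times> nat)) set" where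
  "pivot_rows e n k = (\<lambda>(\<sigma>, v). if e v < e (pivot \<sigma> v) then (\<sigma> - {pivot \<sigma> v}, v, pivot \<sigma> v)
     else (\<sigma> - {pivot \<sigma> v}, pivot \<sigma> v, v)) ` pivot_pairs n k"

text \<open>Restricting a linear relation among the rows to its terms of maximal weight gives a cocycle on chains.\<close>

lemma independent_rows:
  fixes e :: "nat \<times> nat \<Rightarrow> nat"
  assumes k: "k \<ge> 3" and e: "inj_on e (mat_vars n)"
    and rel: "\<And>\<beta> x y z. \<beta> \<subseteq> mat_vars n \<Longrightarrow> card \<beta> = k - 1 \<Longrightarrow>
      x \<in> mat_vars n \<Longrightarrow> y \<in> mat_vars n \<Longrightarrow> z \<in> mat_vars n \<Longrightarrow>
      (\<Sum>(\<sigma>, p, q)\<in>wedge_basis e n k - pivot_rows e n k. b (\<sigma>, p, q) *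
        koszul_entry (Poly_Mapping.lookup (det_poly n)) (set_mon (complement_of n \<sigma>), p, q) (set_mon \<beta>, x, y, z)) = 0"
    and \<rho>: "\<rho> \<in> wedge_basis e n k - pivot_rows e n k"
  shows "b \<rho> = 0"
proof (rule ccontr)
  assume nz: "b \<rho> \<noteq> 0"
  let ?X = "mat_vars n" and ?T = "wedge_basis e n k" and ?Z = "pivot_rows e n k"
  \<comment> \<open>The coefficients are extended by zero to the discarded rows and then, as
    \<open>a0\<close>, to an alternating function on all pairs of variables.\<close>
  define b' where "b' r = (if r \<in> ?T - ?Z then b r else 0)" for r
  define a0 where "a0 \<sigma> p q = (if e p < e q then b' (\<sigma>, p, q) else if e q < e p then - b' (\<sigma>, q, p) else 0)"
    for \<sigma> p q
  have a0_anti: "a0 \<sigma> q p = - a0 \<sigma> p q" for \<sigma> p q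
    by (simp add: a0_def)
  have a0_supp: "\<sigma> \<in> chains ?X k \<and> p \<in> ?X \<and> q \<in> ?X" if "a0 \<sigma> p q \<noteq> 0" for \<sigma> p q
    using that by (auto simp: a0_def b'_def wedge_basis_def opairs_def split: if_splits)
  define D where "D \<alpha> = dcoef (Poly_Mapping.lookup (det_poly n)) \<alpha>" for \<alpha>
  define g where "g \<beta> \<sigma> u = D (set_mon \<beta> + set_mon (complement_of n \<sigma>) + evar u)" for \<beta> \<sigma> u
  define lead where "lead \<sigma> = D (set_mon \<sigma> + set_mon (complement_of n \<sigma>))" for \<sigma>
  have contract: "(\<Sum>(p, q)\<in>opairs e ?X. b' (\<sigma>, p, q) * alt2 p q y z) = a0 \<sigma> y z"
    if "y \<in> ?X" "z \<in> ?X" for \<sigma> y z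
  proof -
    have "(\<Sum>(p, q)\<in>opairs e ?X. b' (\<sigma>, p, q) * alt2 p q y z) = (\<Sum>(p, q)\<in>opairs e ?X. alt2 p q y z * a0 \<sigma> p q)"
      by (rule sum.cong) (auto simp: opairs_def a0_def)
    also have "\<dots> = a0 \<sigma> y z" by (rule sum_opairs_alt2[OF finite_mat_vars e that]) (rule a0_anti)
    finally show ?thesis .
  qed
  have column: "(\<Sum>\<sigma>\<in>chains ?X k. g \<beta> \<sigma> x * a0 \<sigma> y z) + (\<Sum>\<sigma>\<in>chains ?X k. g \<beta> \<sigma> y * a0 \<sigma> z x)
      + (\<Sum>\<sigma>\<in>chains ?X k. g \<beta> \<sigma> z * a0 \<sigma> x y) = 0"
    if "\<beta> \<subseteq> ?X" "card \<beta> = k - 1" and xyz: "x \<in> ?X" "y \<in> ?X" "z \<in> ?X" for \<beta> x y z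
  proof -
    let ?E = "\<lambda>\<sigma> p q. koszul_entry (Poly_Mapping.lookup (det_poly n))
        (set_mon (complement_of n \<sigma>), p, q) (set_mon \<beta>, x, y, z)"
    have finT: "finite ?T" unfolding wedge_basis_def by (intro finite_cartesian_product finite_chains finite_opairs) auto
    have "0 = (\<Sum>(\<sigma>, p, q)\<in>?T - ?Z. b (\<sigma>, p, q) * ?E \<sigma> p q)"
      using rel[OF that] by simp
    also have "\<dots> = (\<Sum>(\<sigma>, p, q)\<in>?T. b' (\<sigma>, p, q) * ?E \<sigma> p q)"
      by (rule sum.mono_neutral_cong_left[OF finT]) (auto simp: b'_def)
    also have "\<dots> = (\<Sum>\<sigma>\<in>chains ?X k. \<Sum>(p, q)\<in>opairs e ?X. b' (\<sigma>, p, q) * ?E \<sigma> p q)"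
      unfolding wedge_basis_def by (simp add: sum.cartesian_product case_prod_unfold)
    also have "\<dots> = (\<Sum>\<sigma>\<in>chains ?X k. g \<beta> \<sigma> x * a0 \<sigma> y z + g \<beta> \<sigma> y * a0 \<sigma> z x + g \<beta> \<sigma> z * a0 \<sigma> x y)"
    proof (rule sum.cong[OF refl])
      fix \<sigma>
      have "(\<Sum>(p, q)\<in>opairs e ?X. b' (\<sigma>, p, q) * ?E \<sigma> p q)
          = g \<beta> \<sigma> x * (\<Sum>(p, q)\<in>opairs e ?X. b' (\<sigma>, p, q) * alt2 p q y z)
          + g \<beta> \<sigma> y * (\<Sum>(p, q)\<in>opairs e ?X. b' (\<sigma>, p, q) * alt2 p q z x)
          + g \<beta> \<sigma> z * (\<Sum>(p, q)\<in>opairs e ?X. b' (\<sigma>, p, q) * alt2 p q x y)"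
        unfolding sum_distrib_left sum.distrib[symmetric]
        by (rule sum.cong) (simp_all add: koszul_entry_def wedge3_def g_def D_def case_prod_unfold algebra_simps)
      then show "(\<Sum>(p, q)\<in>opairs e ?X. b' (\<sigma>, p, q) * ?E \<sigma> p q)
          = g \<beta> \<sigma> x * a0 \<sigma> y z + g \<beta> \<sigma> y * a0 \<sigma> z x + g \<beta> \<sigma> z * a0 \<sigma> x y"
        using xyz by (simp only: contract)
    qed
    finally show ?thesis by (simp add: sum.distrib)
  qed
  \<comment> \<open>Counting the two wedged variables as well gives the three terms of a column the
    same total weight.\<close>
  define wt where "wt \<sigma> p q = weight \<sigma> + fst p * snd p + fst q * snd q" for \<sigma> p q
  define S where "S = {(\<sigma>, p, q). a0 \<sigma> p q \<noteq> 0}"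
  have "S \<subseteq> chains ?X k \<times> ?X \<times> ?X" using a0_supp by (auto simp: S_def)
  then have "finite S" by (rule finite_subset) (intro finite_cartesian_product finite_chains finite_mat_vars)
  obtain \<sigma>1 p1 q1 where \<rho>1: "\<rho> = (\<sigma>1, p1, q1)" by (cases \<rho>)
  have "a0 \<sigma>1 p1 q1 \<noteq> 0"
    using nz \<rho> unfolding \<rho>1 by (auto simp: a0_def b'_def wedge_basis_def opairs_def)
  then have "(\<sigma>1, p1, q1) \<in> S" by (simp add: S_def)
  then have "S \<noteq> {}" by blast
  define \<Omega> where "\<Omega> = Max ((\<lambda>(\<sigma>, p, q). wt \<sigma> p q) ` S)"
  have le_\<Omega>: "wt \<sigma> p q \<le> \<Omega>" if "a0 \<sigma> p q \<noteq> 0" for \<sigma> p q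
  proof -
    have "(\<sigma>, p, q) \<in> S" using that by (simp add: S_def)
    then have "wt \<sigma> p q \<in> (\<lambda>(\<sigma>, p, q). wt \<sigma> p q) ` S" by (rule rev_image_eqI) simp
    then show ?thesis unfolding \<Omega>_def using \<open>finite S\<close> by (intro Max_ge) auto
  qed
  have "\<Omega> \<in> (\<lambda>(\<sigma>, p, q). wt \<sigma> p q) ` S"
    unfolding \<Omega>_def by (rule Max_in) (use \<open>finite S\<close> \<open>S \<noteq> {}\<close> in auto)
  then obtain \<rho>0 where "\<rho>0 \<in> S" "\<Omega> = (\<lambda>(\<sigma>, p, q). wt \<sigma> p q) \<rho>0" by (rule imageE) blast
  then obtain \<sigma>0 p0 q0 where top: "a0 \<sigma>0 p0 q0 \<noteq> 0" "wt \<sigma>0 p0 q0 = \<Omega>"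
    by (cases \<rho>0) (simp add: S_def)
  \<comment> \<open>Only the terms of top weight are kept; the factor \<open>lead \<sigma>\<close>
    absorbs the leading coefficients of the minors, so that the plain cocycle equation
    results.\<close>
  define a where "a \<sigma> p q = (if wt \<sigma> p q = \<Omega> then lead \<sigma> * a0 \<sigma> p q else 0)" for \<sigma> p q
  \<comment> \<open>Another \<sigma> that contributes would be heavier than
    \<open>insert x \<beta>\<close>, and its 2-form would exceed the maximal weight
    \<Omega>.\<close>
  have leading: "(\<Sum>\<sigma>\<in>chains ?X k. g \<beta> \<sigma> x * a0 \<sigma> y z) = (if x \<in> \<beta> then 0 else a (insert x \<beta>) y z)"
    if "finite \<beta>" and total: "x \<notin> \<beta> \<Longrightarrow> wt (insert x \<beta>) y z = \<Omega>" for \<beta> x y z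
  proof -
    have summand: "g \<beta> \<sigma> x * a0 \<sigma> y z = (if x \<notin> \<beta> \<and> insert x \<beta> = \<sigma> then a \<sigma> y z else 0)"
      if \<sigma>: "\<sigma> \<in> chains ?X k" for \<sigma>
    proof (cases "g \<beta> \<sigma> x \<noteq> 0 \<and> a0 \<sigma> y z \<noteq> 0")
      case True
      have chain: "strict_chain \<sigma>" using \<sigma> by (simp add: chains_def)
      have "dcoef (Poly_Mapping.lookup (det_poly n)) (set_mon \<beta> + set_mon (complement_of n \<sigma>) + evar x) \<noteq> 0"
        using True by (simp add: g_def D_def)
      from det_coef_leading[OF chain complement_of(1,2)[OF \<sigma>] \<open>finite \<beta>\<close> this]
      have x: "x \<notin> \<beta>" and "insert x \<beta> = \<sigma> \<or> weight (insert x \<beta>) < weight \<sigma>" by auto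
      moreover have "\<not> weight (insert x \<beta>) < weight \<sigma>"
        using total[OF x] le_\<Omega>[of \<sigma> y z] True by (auto simp: wt_def)
      ultimately have ins: "insert x \<beta> = \<sigma>" by blast
      have "set_mon \<sigma> = evar x + set_mon \<beta>"
        unfolding ins[symmetric] by (rule set_mon_insert) (use \<open>finite \<beta>\<close> x in auto)
      then have "g \<beta> \<sigma> x = lead \<sigma>" by (simp add: g_def lead_def add_ac)
      then show ?thesis using x ins total[OF x] by (simp add: a_def)
    next
      case False
      have "a \<sigma> y z = 0" if "x \<notin> \<beta>" "insert x \<beta> = \<sigma>"
      proof -
        have "set_mon \<sigma> = evar x + set_mon \<beta>"
          unfolding that(2)[symmetric] by (rule set_mon_insert) (use \<open>finite \<beta>\<close> that in auto)
        then have "g \<beta> \<sigma> x = lead \<sigma>" by (simp add: g_def lead_def add_ac)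
        then show ?thesis using False by (auto simp: a_def)
      qed
      then show ?thesis using False by auto
    qed
    show ?thesis
    proof (cases "x \<in> \<beta>")
      case True
      then show ?thesis by (simp add: summand)
    next
      case False
      have "(\<Sum>\<sigma>\<in>chains ?X k. g \<beta> \<sigma> x * a0 \<sigma> y z)
          = (\<Sum>\<sigma>\<in>chains ?X k. if insert x \<beta> = \<sigma> then a \<sigma> y z else 0)"
        by (rule sum.cong) (use False summand in auto)
      also have "\<dots> = (if insert x \<beta> \<in> chains ?X k then a (insert x \<beta>) y z else 0)"
        by (simp add: finite_chains)
      also have "\<dots> = a (insert x \<beta>) y z"
        using a0_supp[of "insert x \<beta>" y z] by (auto simp: a_def)
      finally show ?thesis using False by simp
    qed
  qed
  interpret chain_cocycle ?X k a
  proof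
    show "finite ?X" "k \<ge> 3" using k by auto
    show "a \<sigma> q p = - a \<sigma> p q" for \<sigma> p q
      unfolding a_def a0_anti[of \<sigma> q p] by (simp add: wt_def add_ac)
    show "\<sigma> \<in> chains ?X k \<and> p \<in> ?X \<and> q \<in> ?X" if "a \<sigma> p q \<noteq> 0" for \<sigma> p q
      using that a0_supp[of \<sigma> p q] by (auto simp: a_def split: if_splits)
    show "(if x \<in> \<beta> then 0 else a (insert x \<beta>) y z) + (if y \<in> \<beta> then 0 else a (insert y \<beta>) z x)
          + (if z \<in> \<beta> then 0 else a (insert z \<beta>) x y) = 0"
      if \<beta>: "\<beta> \<subseteq> ?X" "card \<beta> = k - 1" and xyz: "x \<in> ?X" "y \<in> ?X" "z \<in> ?X" for \<beta> x y z
    proof -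
      have fin: "finite \<beta>" using \<beta>(1) by (rule finite_subset) simp
      have wt_insert: "wt (insert x \<beta>) y z = weight \<beta> + fst x * snd x + fst y * snd y + fst z * snd z"
        if "x \<notin> \<beta>" for x y z
        using that fin by (simp add: wt_def weight_def)
      show ?thesis
      proof (cases "weight \<beta> + fst x * snd x + fst y * snd y + fst z * snd z = \<Omega>")
        case True
        have "(\<Sum>\<sigma>\<in>chains ?X k. g \<beta> \<sigma> x * a0 \<sigma> y z) = (if x \<in> \<beta> then 0 else a (insert x \<beta>) y z)"
          "(\<Sum>\<sigma>\<in>chains ?X k. g \<beta> \<sigma> y * a0 \<sigma> z x) = (if y \<in> \<beta> then 0 else a (insert y \<beta>) z x)"
          "(\<Sum>\<sigma>\<in>chains ?X k. g \<beta> \<sigma> z * a0 \<sigma> x y) = (if z \<in> \<beta> then 0 else a (insert z \<beta>) x y)"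
          using True wt_insert by (intro leading[OF fin]; simp)+
        then show ?thesis using column[OF \<beta> xyz] by simp
      next
        case False
        then have "(if x \<in> \<beta> then 0 else a (insert x \<beta>) y z) = 0"
          "(if y \<in> \<beta> then 0 else a (insert y \<beta>) z x) = 0"
          "(if z \<in> \<beta> then 0 else a (insert z \<beta>) x y) = 0"
          using wt_insert by (simp_all add: a_def)
        then show ?thesis by simp
      qed
    qed
    show "a (\<sigma> - {pivot \<sigma> v}) v (pivot \<sigma> v) = 0"
      if "\<sigma> \<in> chains ?X (Suc k)" "v \<in> ?X" "\<exists>s\<in>\<sigma>. \<not> strict_less v s" for \<sigma> v
    proof -
      have "(\<sigma>, v) \<in> pivot_pairs n k" using that by (simp add: pivot_pairs_def)
      from imageI[OF this, of "\<lambda>(\<sigma>, v). if e v < e (pivot \<sigma> v) then (\<sigma> - {pivot \<sigma> v}, v, pivot \<sigma> v)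
          else (\<sigma> - {pivot \<sigma> v}, pivot \<sigma> v, v)"]
      have "(if e v < e (pivot \<sigma> v) then (\<sigma> - {pivot \<sigma> v}, v, pivot \<sigma> v)
          else (\<sigma> - {pivot \<sigma> v}, pivot \<sigma> v, v)) \<in> ?Z"
        by (simp add: pivot_rows_def)
      then have "a0 (\<sigma> - {pivot \<sigma> v}) v (pivot \<sigma> v) = 0"
        by (auto simp: a0_def b'_def split: if_splits)
      then show ?thesis by (simp add: a_def)
    qed
  qed
  have "\<sigma>0 \<in> chains ?X k" using a0_supp[OF top(1)] by blast
  then have "lead \<sigma>0 \<noteq> 0"
    unfolding lead_def D_def by (intro det_coef_chain complement_of(1,2))
  then have "a \<sigma>0 p0 q0 \<noteq> 0" using top by (simp add: a_def)
  then show False by (simp add: cocycle_zero)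
qed

subsection \<open>Counting strict chains\<close>

lemma chain_with_shadow:
  fixes I K :: "nat set"
  assumes "finite I" "finite K" "card I = k" "card K = k"
  shows "\<exists>\<sigma>. card \<sigma> = k \<and> strict_chain \<sigma> \<and> fst ` \<sigma> = I \<and> snd ` \<sigma> = K"
proof -
  obtain h where h: "bij_betw h {..<k} I" "strict_mono_on {..<k} h"
    using ex_bij_betw_strict_mono_card[OF assms(1)] assms(3) by metis
  obtain h' where h': "bij_betw h' {..<k} K" "strict_mono_on {..<k} h'"
    using ex_bij_betw_strict_mono_card[OF assms(2)] assms(4) by metis
  let ?\<sigma> = "(\<lambda>i. (h i, h' i)) ` {..<k}"
  have "inj_on (\<lambda>i. (h i, h' i)) {..<k}" using h(1) by (auto simp: bij_betw_def inj_on_def)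
  then have "card ?\<sigma> = k" by (simp add: card_image)
  moreover have "strict_chain ?\<sigma>"
    unfolding strict_chain_def
  proof (intro ballI impI)
    fix p q assume "p \<in> ?\<sigma>" "q \<in> ?\<sigma>" "p \<noteq> q"
    then obtain i j where ij: "i < k" "j < k" "i \<noteq> j" and pq: "p = (h i, h' i)" "q = (h j, h' j)"
      by blast
    from ij(3) consider "i < j" | "j < i" by linarith
    then show "comparable p q"
      unfolding pq comparable_def strict_less_def fst_conv snd_conv
      using strict_mono_onD[OF h(2)] strict_mono_onD[OF h'(2)] ij(1,2) by cases auto
  qed
  moreover have "fst ` ?\<sigma> = I" "snd ` ?\<sigma> = K"
    using h(1) h'(1) by (auto simp: image_image bij_betw_def)
  ultimately show ?thesis by blast
qed

text \<open>A strict chain amounts to a choice of \<open>k\<close> rows and \<open>k\<close>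
  columns. Uniqueness comes from the weights: of two different chains with the same rows and
  columns, each would be lighter than the other.\<close>

lemma card_chains: "card (chains (mat_vars n) k) = (n choose k)\<^sup>2"
proof -
  let ?P = "{I. I \<subseteq> {..<n} \<and> card I = k}"
  have fin: "finite \<sigma>" if "\<sigma> \<in> chains (mat_vars n) k" for \<sigma>
    using that by (auto simp: chains_def intro: finite_subset[OF _ finite_mat_vars])
  have "bij_betw (\<lambda>\<sigma>. (fst ` \<sigma>, snd ` \<sigma>)) (chains (mat_vars n) k) (?P \<times> ?P)"
    unfolding bij_betw_def
  proof (intro conjI equalityI subsetI)
    show "inj_on (\<lambda>\<sigma>. (fst ` \<sigma>, snd ` \<sigma>)) (chains (mat_vars n) k)"
    proof (rule inj_onI)
      fix \<sigma> \<tau> assume st: "\<sigma> \<in> chains (mat_vars n) k" "\<tau> \<in> chains (mat_vars n) k"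
        and eq: "(fst ` \<sigma>, snd ` \<sigma>) = (fst ` \<tau>, snd ` \<tau>)"
      have ch: "strict_chain \<sigma>" "strict_chain \<tau>" using st by (auto simp: chains_def)
      have "same_shadow \<sigma> \<tau>" "same_shadow \<tau> \<sigma>"
        using eq strict_chain_inj[OF ch(1)] strict_chain_inj[OF ch(2)] by (auto simp: same_shadow_def)
      then show "\<sigma> = \<tau>"
        using weight_less_chain[OF fin[OF st(1)] ch(1), of \<tau>] weight_less_chain[OF fin[OF st(2)] ch(2), of \<sigma>]
        by fastforce
    qed
  next
    fix IK assume "IK \<in> (\<lambda>\<sigma>. (fst ` \<sigma>, snd ` \<sigma>)) ` chains (mat_vars n) k"
    then obtain \<sigma> where \<sigma>: "\<sigma> \<in> chains (mat_vars n) k" "IK = (fst ` \<sigma>, snd ` \<sigma>)" by blast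
    have "card (fst ` \<sigma>) = k" "card (snd ` \<sigma>) = k"
      using strict_chain_inj[of \<sigma>] \<sigma>(1) by (auto simp: card_image chains_def)
    moreover have "fst ` \<sigma> \<subseteq> {..<n}" "snd ` \<sigma> \<subseteq> {..<n}" using \<sigma>(1) by (auto simp: chains_def mat_vars_def)
    ultimately show "IK \<in> ?P \<times> ?P" using \<sigma>(2) by simp
  next
    fix IK assume "IK \<in> ?P \<times> ?P"
    then obtain I K where IK: "IK = (I, K)" "I \<subseteq> {..<n}" "K \<subseteq> {..<n}" "card I = k" "card K = k" by auto
    then obtain \<sigma> where \<sigma>: "card \<sigma> = k" "strict_chain \<sigma>" "fst ` \<sigma> = I" "snd ` \<sigma> = K"
      using chain_with_shadow[of I K k] finite_subset[OF _ finite_lessThan] by metis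
    have "\<sigma> \<subseteq> I \<times> K" using \<sigma>(3,4) by force
    then have "\<sigma> \<in> chains (mat_vars n) k" using IK \<sigma> by (auto simp: chains_def mat_vars_def)
    then show "IK \<in> (\<lambda>\<sigma>. (fst ` \<sigma>, snd ` \<sigma>)) ` chains (mat_vars n) k"
      by (rule rev_image_eqI) (simp add: IK \<sigma>)
  qed
  then have "card (chains (mat_vars n) k) = card (?P \<times> ?P)" by (rule bij_betw_same_card)
  also have "\<dots> = (n choose k)\<^sup>2"
    using n_subsets[of "{..<n}" k] by (simp add: card_cartesian_product power2_eq_square)
  finally show ?thesis .
qed

lemma card_mat_vars: "card (mat_vars n) = n\<^sup>2"
  by (simp add: mat_vars_def power2_eq_square)

text \<open>The complementary pairs, with \<open>v\<close> below the whole chain, are in bijection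
  with chains of size \<open>k + 2\<close>: adjoin \<open>v\<close>, or split off the least
  element.\<close>

lemma card_pivot_pairs:
  "card (pivot_pairs n k) + (n choose (k + 2))\<^sup>2 = (n choose (k + 1))\<^sup>2 * n\<^sup>2"
proof -
  let ?X = "mat_vars n"
  let ?L = "{(\<sigma>, v). \<sigma> \<in> chains ?X (Suc k) \<and> v \<in> ?X \<and> (\<forall>s\<in>\<sigma>. strict_less v s)}"
  have fin: "finite \<sigma>" if "\<sigma> \<subseteq> ?X" for \<sigma> using that by (rule finite_subset) simp
  have "bij_betw (\<lambda>(\<sigma>, v). insert v \<sigma>) ?L (chains ?X (k + 2))"
    unfolding bij_betw_def
  proof (intro conjI equalityI subsetI)
    show "inj_on (\<lambda>(\<sigma>, v). insert v \<sigma>) ?L"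
    proof (rule inj_onI)
      fix a b assume ab: "a \<in> ?L" "b \<in> ?L" and eq: "(\<lambda>(\<sigma>, v). insert v \<sigma>) a = (\<lambda>(\<sigma>, v). insert v \<sigma>) b"
      obtain \<sigma> v \<tau> w where [simp]: "a = (\<sigma>, v)" "b = (\<tau>, w)" by (cases a; cases b) auto
      have "least_in (insert v \<sigma>) v" "least_in (insert w \<tau>) w" using ab by (auto simp: least_in_def)
      then have "v = w" using eq least_in_unique by auto
      moreover have "v \<notin> \<sigma>" "w \<notin> \<tau>" using ab by auto
      ultimately show "a = b" using eq by (auto simp: insert_ident)
    qed
  next
    fix \<omega> assume "\<omega> \<in> (\<lambda>(\<sigma>, v). insert v \<sigma>) ` ?L"
    then obtain \<sigma> v where \<sigma>: "\<omega> = insert v \<sigma>" "\<sigma> \<subseteq> ?X" "card \<sigma> = Suc k" "strict_chain \<sigma>" "v \<in> ?X"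
      and v: "\<And>s. s \<in> \<sigma> \<Longrightarrow> strict_less v s"
      by (auto simp: chains_def)
    have "v \<notin> \<sigma>" using v[of v] by auto
    then have "card \<omega> = k + 2" using \<sigma>(1-3) fin by simp
    moreover have "strict_chain \<omega>"
      using \<sigma>(4) v unfolding \<sigma>(1) strict_chain_def comparable_def by blast
    ultimately show "\<omega> \<in> chains ?X (k + 2)" using \<sigma> by (simp add: chains_def)
  next
    fix \<omega> assume "\<omega> \<in> chains ?X (k + 2)"
    then have \<omega>: "\<omega> \<subseteq> ?X" "card \<omega> = k + 2" "strict_chain \<omega>" by (auto simp: chains_def)
    then obtain m where m: "least_in \<omega> m" using strict_chain_least[of \<omega>] fin by fastforce
    have "\<omega> - {m} \<in> chains ?X (Suc k)"
      using \<omega> m fin strict_chain_subset[of \<omega> "\<omega> - {m}"] by (auto simp: chains_def least_in_def)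
    then have "(\<omega> - {m}, m) \<in> ?L" using m \<omega>(1) by (auto simp: least_in_def)
    then have "(\<lambda>(\<sigma>, v). insert v \<sigma>) (\<omega> - {m}, m) \<in> (\<lambda>(\<sigma>, v). insert v \<sigma>) ` ?L"
      by (rule imageI)
    then show "\<omega> \<in> (\<lambda>(\<sigma>, v). insert v \<sigma>) ` ?L"
      using m by (simp add: least_in_def insert_absorb)
  qed
  then have L: "card ?L = (n choose (k + 2))\<^sup>2"
    by (rule bij_betw_same_card[THEN trans]) (rule card_chains)
  have un: "pivot_pairs n k \<union> ?L = chains ?X (Suc k) \<times> ?X" "pivot_pairs n k \<inter> ?L = {}"
    by (auto simp: pivot_pairs_def)
  have finU: "finite (chains ?X (Suc k) \<times> ?X)" by (simp add: finite_chains)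
  have "card (pivot_pairs n k \<union> ?L) = card (pivot_pairs n k) + card ?L"
    by (rule card_Un_disjoint[OF _ _ un(2)]) (use finU un(1) in \<open>auto intro: finite_subset\<close>)
  moreover have "card (chains ?X (Suc k) \<times> ?X) = (n choose (k + 1))\<^sup>2 * n\<^sup>2"
    by (simp add: card_cartesian_product card_chains card_mat_vars)
  ultimately show ?thesis unfolding un(1) L by simp
qed

lemma card_independent_rows:
  assumes "inj_on e (mat_vars n)"
  shows "(n choose k)\<^sup>2 * (n\<^sup>2 choose 2) + (n choose (k + 2))\<^sup>2
    \<le> card (wedge_basis e n k - pivot_rows e n k) + (n choose (k + 1))\<^sup>2 * n\<^sup>2"
proof -
  have finP: "finite (pivot_pairs n k)"
    by (rule finite_subset[of _ "chains (mat_vars n) (Suc k) \<times> mat_vars n"])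
       (auto simp: pivot_pairs_def finite_chains)
  have "card (wedge_basis e n k) = (n choose k)\<^sup>2 * (n\<^sup>2 choose 2)"
    unfolding wedge_basis_def
    by (simp add: card_cartesian_product card_chains card_opairs[OF _ assms] card_mat_vars)
  moreover have "card (pivot_rows e n k) \<le> card (pivot_pairs n k)"
    unfolding pivot_rows_def by (rule card_image_le[OF finP])
  moreover have "card (wedge_basis e n k) - card (pivot_rows e n k) \<le> card (wedge_basis e n k - pivot_rows e n k)"
    by (rule diff_card_le_card_Diff) (simp add: pivot_rows_def finP)
  ultimately show ?thesis using card_pivot_pairs[of n k] by linarith
qed

subsection \<open>The lower bound\<close>

text \<open>If there were more independent rows than rank at most \<open>r\<close> allows, some
  nonzero minor for the determinant would be a polynomial vanishing on all forms of rank at most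
  \<open>r\<close>, against membership in the closure.\<close>

lemma border_rank_bound:
  assumes k: "3 \<le> k" "k \<le> n"
    and closure: "det_poly n \<in> zariski_closure (mat_vars n) n
      {Q \<in> sym_power (mat_vars n) n. sym_rank (mat_vars n) n Q \<le> enat r}"
  shows "(n choose k)\<^sup>2 * (n\<^sup>2 choose 2) + (n choose (k + 2))\<^sup>2
    \<le> r * ((n\<^sup>2 - 1) choose 2) + (n choose (k + 1))\<^sup>2 * n\<^sup>2"
proof -
  let ?X = "mat_vars n"
  obtain e :: "nat \<times> nat \<Rightarrow> nat" where e: "inj_on e ?X"
    using finite_imp_inj_to_nat_seg[OF finite_mat_vars] by metis
  let ?T = "wedge_basis e n k - pivot_rows e n k"
  define R where "R = card ?T"
  have "R \<le> r * ((n\<^sup>2 - 1) choose 2)"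
  proof (rule ccontr)
    assume "\<not> R \<le> r * ((n\<^sup>2 - 1) choose 2)"
    then have less: "r * ((card ?X - 1) choose 2) < R" by (simp add: card_mat_vars)
    have "finite ?T"
      unfolding wedge_basis_def by (intro finite_Diff finite_cartesian_product finite_chains finite_opairs) auto
    then obtain h where h: "bij_betw h {..<R} ?T"
      unfolding R_def using ex_bij_betw_nat_finite[of ?T] by (auto simp: atLeast0LessThan)
    define rw where "rw i = (\<lambda>(\<sigma>, p, q). (set_mon (complement_of n \<sigma>), p, q)) (h i)" for i
    define Cols where "Cols = {(set_mon \<beta>, x, y, z) | \<beta> x y z.
      \<beta> \<subseteq> ?X \<and> card \<beta> = k - 1 \<and> x \<in> ?X \<and> y \<in> ?X \<and> z \<in> ?X}"
    let ?K = "\<lambda>a i c. koszul_entry a (rw i) c"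
    have "\<exists>c. (\<forall>j<R. c j \<in> Cols) \<and>
        Determinant.det (mat R R (\<lambda>(i, j). ?K (Poly_Mapping.lookup (det_poly n)) i (c j))) \<noteq> 0"
    proof (rule independent_imp_minor)
      fix a :: "nat \<Rightarrow> complex" and i
      assume rel: "\<And>c. c \<in> Cols \<Longrightarrow> (\<Sum>i<R. a i * ?K (Poly_Mapping.lookup (det_poly n)) i c) = 0" and "i < R"
      \<comment> \<open>The coefficients are transported from positions \<open>i < R\<close> to the
        basis elements they enumerate.\<close>
      define b where "b \<rho> = a (inv_into {..<R} h \<rho>)" for \<rho>
      have bh: "b (h i) = a i" if "i < R" for i
        unfolding b_def using bij_betw_inv_into_left[OF h, of i] that by simp
      have "b (h i) = 0"
      proof (rule independent_rows[OF k(1) e])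
        show "h i \<in> ?T" using h \<open>i < R\<close> by (auto simp: bij_betw_def)
        fix \<beta> x y z
        assume "\<beta> \<subseteq> ?X" "card \<beta> = k - 1" "x \<in> ?X" "y \<in> ?X" "z \<in> ?X"
        then have "(set_mon \<beta>, x, y, z) \<in> Cols" unfolding Cols_def by blast
        from rel[OF this]
        have "0 = (\<Sum>i<R. b (h i) * ?K (Poly_Mapping.lookup (det_poly n)) i (set_mon \<beta>, x, y, z))"
          using bh by simp
        also have "\<dots> = (\<Sum>\<rho>\<in>?T. b \<rho> * koszul_entry (Poly_Mapping.lookup (det_poly n))
            ((\<lambda>(\<sigma>, p, q). (set_mon (complement_of n \<sigma>), p, q)) \<rho>) (set_mon \<beta>, x, y, z))"
          unfolding rw_def by (rule sum.reindex_bij_betw[OF h])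
        finally show "(\<Sum>(\<sigma>, p, q)\<in>?T. b (\<sigma>, p, q) * koszul_entry (Poly_Mapping.lookup (det_poly n))
            (set_mon (complement_of n \<sigma>), p, q) (set_mon \<beta>, x, y, z)) = 0"
          by (simp add: case_prod_unfold)
      qed
      then show "a i = 0" using bh \<open>i < R\<close> by simp
    qed
    then obtain c where c: "\<And>j. j < R \<Longrightarrow> c j \<in> Cols"
      and nz: "Determinant.det (mat R R (\<lambda>(i, j). ?K (Poly_Mapping.lookup (det_poly n)) i (c j))) \<noteq> 0"
      by blast
    obtain F where F: "\<And>a. poly_eval F a = Determinant.det (mat R R (\<lambda>(i, j). ?K a i (c j)))"
      using polynomial_fun_det[of R "\<lambda>i j a. ?K a i (c j)"] polynomial_fun_koszul_entry
      unfolding polynomial_fun_def by metis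
    have rw: "case rw i of (m, p, q) \<Rightarrow> p \<in> ?X \<and> q \<in> ?X \<and> mon_degree m = n - k" if "i < R" for i
    proof -
      obtain \<sigma> p q where hi: "h i = (\<sigma>, p, q)" by (cases "h i")
      have "(\<sigma>, p, q) \<in> ?T" using h that hi by (metis bij_betwE lessThan_iff)
      then have "\<sigma> \<in> chains ?X k" "p \<in> ?X" "q \<in> ?X" by (auto simp: wedge_basis_def opairs_def)
      then show ?thesis
        using complement_of(3,4) by (simp add: rw_def hi mon_degree_set_mon)
    qed
    \<comment> \<open>The degrees add up as \<open>(n - k) + (k - 1) + 1 = n\<close>; the last
      summand belongs to the single variable \<open>u\<close> in
      \<open>koszul_entry\<close>.\<close>
    have cl: "Suc (n - k + mon_degree (fst (c j))) = n" if j: "j < R" for j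
    proof -
      obtain \<beta> x y z where "c j = (set_mon \<beta>, x, y, z)" "\<beta> \<subseteq> ?X" "card \<beta> = k - 1"
        using c[OF j] unfolding Cols_def by blast
      moreover have "finite \<beta>" using \<open>\<beta> \<subseteq> ?X\<close> by (rule finite_subset) simp
      ultimately show ?thesis using k by (simp add: mon_degree_set_mon)
    qed
    have "poly_eval F (Poly_Mapping.lookup Q) = 0" if "sym_rank ?X n Q \<le> enat r" for Q
      unfolding F by (rule koszul_minor_zero[OF finite_mat_vars e that less rw cl])
    then have "poly_eval F (Poly_Mapping.lookup (det_poly n)) = 0"
      using closure unfolding zariski_closure_def by blast
    then show False using nz F by simp
  qed
  then show ?thesis using card_independent_rows[OF e, of k] unfolding R_def by linarith
qed

section \<open>Real arithmetic for the closed form of the bound\<close>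

lemma of_nat_choose_2: "real (m choose 2) = real m * (real m - 1) / 2"
proof (cases m)
  case (Suc m')
  then show ?thesis using choose_two[of m] by (simp add: real_of_nat_div algebra_simps)
qed simp

lemma binomial_step: "real (k + 1) * real (n choose (k + 1)) = real (n - k) * real (n choose k)"
proof -
  have "(k + 1) * (n choose (k + 1)) = (n - k) * (n choose k)"
    using binomial_absorption[of k n] binomial_absorb_comp[of n k] by simp
  then show ?thesis by (metis of_nat_mult)
qed

text \<open>A finite border rank is attained, and an infinite one exceeds every real number.\<close>

lemma ereal_le_sym_border_rank:
  assumes "\<And>r. P \<in> zariski_closure X d {Q \<in> sym_power X d. sym_rank X d Q \<le> enat r} \<Longrightarrow> x \<le> real r"
  shows "ereal x \<le> ereal_of_enat (sym_border_rank X d P)"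
proof (cases "sym_border_rank X d P")
  case (enat r)
  then have "sym_border_rank X d P \<in>
      {enat r | r. P \<in> zariski_closure X d {Q \<in> sym_power X d. sym_rank X d Q \<le> enat r}}"
    unfolding sym_border_rank_def by (intro Inf_enat_in) auto
  then show ?thesis using assms enat by auto
qed simp

text \<open>\<open>u\<close> and \<open>w\<close> are the factors leading from
  \<open>n choose k\<close> to \<open>n choose (k + 1)\<close> and on to
  \<open>n choose (k + 2)\<close>, so every square becomes a multiple of that of
  \<open>n choose k\<close>.\<close>

lemma border_rank_bound_real:
  assumes k: "3 \<le> k" "k \<le> n"
    and closure: "det_poly n \<in> zariski_closure (mat_vars n) n
      {Q \<in> sym_power (mat_vars n) n. sym_rank (mat_vars n) n Q \<le> enat r}"
  defines "N \<equiv> real n ^ 2"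
    and "u \<equiv> real (n - k) / real (k + 1)" and "w \<equiv> real (n - k - 1) / real (k + 2)"
  shows "(N * (N - 1) / 2 - u\<^sup>2 * N + (u * w)\<^sup>2) * real (n choose k) ^ 2 \<le> real r * ((N - 1) * (N - 2) / 2)"
proof -
  let ?B = "real (n choose k)"
  have B1: "real (n choose (k + 1)) = u * ?B"
    using binomial_step[of k n] by (simp add: u_def field_simps)
  have "real (n choose (k + 2)) = w * real (n choose (k + 1))"
    using binomial_step[of "k + 1" n] by (simp add: w_def field_simps)
  then have B2: "real (n choose (k + 2)) = u * w * ?B" using B1 by simp
  have n2: "n\<^sup>2 \<ge> 1" using k by simp
  have "real ((n choose k)\<^sup>2 * (n\<^sup>2 choose 2) + (n choose (k + 2))\<^sup>2)
      \<le> real (r * ((n\<^sup>2 - 1) choose 2) + (n choose (k + 1))\<^sup>2 * n\<^sup>2)"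
    using border_rank_bound[OF k closure] by (rule of_nat_mono)
  then have "?B\<^sup>2 * (N * (N - 1) / 2) + (u * w * ?B)\<^sup>2 \<le> real r * ((N - 1) * (N - 2) / 2) + (u * ?B)\<^sup>2 * N"
    using n2 by (simp only: of_nat_add of_nat_mult of_nat_power of_nat_choose_2 B1 B2 of_nat_diff)
       (simp add: N_def algebra_simps)
  moreover have "(M - u\<^sup>2 * N + (u * w)\<^sup>2) * ?B\<^sup>2 = ?B\<^sup>2 * M + (u * w * ?B)\<^sup>2 - (u * ?B)\<^sup>2 * N" for M
    by (simp add: power_mult_distrib algebra_simps)
  ultimately show ?thesis by simp
qed

text \<open>The case \<open>k = x\<close> and \<open>n = 2 * x\<close>: the constant of the theorem,
  multiplied by the value of \<open>(n\<^sup>2 - 1) choose 2\<close>, is the coefficient in the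
  preceding bound.\<close>

lemma even_identity:
  fixes x :: real
  assumes "x \<ge> 1"
  defines "n \<equiv> 2 * x" and "u \<equiv> x / (x + 1)" and "w \<equiv> (x - 1) / (x + 2)"
  shows "(1 + 8 * (-8 + 6 * n ^ 2 + n ^ 3) / ((-1 + n) * (2 + n) * (4 + n) ^ 2 * (-2 + n ^ 2)))
      * ((n\<^sup>2 - 1) * (n\<^sup>2 - 2) / 2) = n\<^sup>2 * (n\<^sup>2 - 1) / 2 - u\<^sup>2 * n\<^sup>2 + (u * w)\<^sup>2"
proof -
  have "x * x \<ge> 1 * 1" using assms(1) by (intro mult_mono) auto
  then have nz: "-1 + 2 * x \<noteq> 0" "2 + 2 * x \<noteq> 0" "4 + 2 * x \<noteq> 0" "-2 + (2 * x)\<^sup>2 \<noteq> 0" "x + 1 \<noteq> 0" "x + 2 \<noteq> 0"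
    using assms(1) by (auto simp: power2_eq_square)
  show ?thesis
    unfolding n_def u_def w_def power_divide power_mult_distrib[of "_ / _"] times_divide_times_eq
    using nz by (simp add: divide_simps) (simp add: algebra_simps power2_eq_square power3_eq_cube)
qed

text \<open>The same for \<open>k = x\<close> and \<open>n = 2 * x - 1\<close>, where
  \<open>n - k = x - 1\<close>.\<close>

lemma odd_identity:
  fixes x :: real
  assumes "x \<ge> 2"
  defines "n \<equiv> 2 * x - 1" and "u \<equiv> (x - 1) / (x + 1)" and "w \<equiv> (x - 2) / (x + 2)"
  shows "(1 + 16 * (9 + 8 * n + n ^ 2) / ((3 + n) * (5 + n) ^ 2 * (-2 + n ^ 2)))
      * ((n\<^sup>2 - 1) * (n\<^sup>2 - 2) / 2) = n\<^sup>2 * (n\<^sup>2 - 1) / 2 - u\<^sup>2 * n\<^sup>2 + (u * w)\<^sup>2"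
proof -
  have "(2 * x - 1) * (2 * x - 1) \<ge> 3 * 3" using assms(1) by (intro mult_mono) auto
  then have nz: "3 + (2 * x - 1) \<noteq> 0" "5 + (2 * x - 1) \<noteq> 0" "-2 + (2 * x - 1)\<^sup>2 \<noteq> 0" "x + 1 \<noteq> 0" "x + 2 \<noteq> 0"
    using assms(1) by (auto simp: power2_eq_square)
  show ?thesis
    unfolding n_def u_def w_def
    using nz by (simp add: divide_simps) (simp add: algebra_simps power2_eq_square power3_eq_cube)
qed

lemma le_from_scaled:
  fixes L B r M c :: real
  assumes "M * B \<le> r * L" "c * L = M" "L > 0"
  shows "c * B \<le> r"
proof -
  have "c * B * L \<le> r * L" using assms(1,2) by (simp add: mult_ac)
  then show ?thesis using assms(3) by simp
qed

theorem mainTheorem1: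
  fixes n :: nat
  assumes "n \<ge> 5"
  shows "(even n \<longrightarrow>
      ereal_of_enat (sym_border_rank (mat_vars n) n (det_poly n)) \<ge>
      ereal ((1 + 8 * (-8 + 6 * real n ^ 2 + real n ^ 3) /
               ((-1 + real n) * (2 + real n) * (4 + real n) ^ 2 * (-2 + real n ^ 2)))
             * real (n choose (n div 2)) ^ 2))
    \<and> (odd n \<longrightarrow>
      ereal_of_enat (sym_border_rank (mat_vars n) n (det_poly n)) \<ge>
      ereal ((1 + 16 * (9 + 8 * real n + real n ^ 2) /
               ((3 + real n) * (5 + real n) ^ 2 * (-2 + real n ^ 2)))
             * real (n choose ((n - 1) div 2)) ^ 2))"
proof (intro conjI impI ereal_le_sym_border_rank)
  fix r
  assume closure: "det_poly n \<in> zariski_closure (mat_vars n) n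
      {Q \<in> sym_power (mat_vars n) n. sym_rank (mat_vars n) n Q \<le> enat r}"
  have "real n * real n \<ge> 5 * 5" using assms by (intro mult_mono) auto
  \<comment> \<open>The value of \<open>(n\<^sup>2 - 1) choose 2\<close>, by which the inequality is
    finally divided.\<close>
  then have pos: "((real n)\<^sup>2 - 1) * ((real n)\<^sup>2 - 2) / 2 > 0"
    by (simp add: power2_eq_square)
  {
    assume "even n"
    then obtain h where h: "n = 2 * h" by (elim evenE)
    \<comment> \<open>An even \<open>n \<ge> 5\<close> is at least 6, so \<open>k = h\<close>
      reaches 3.\<close>
    have k: "3 \<le> h" "h \<le> n" using assms h by auto
    have x: "real n = 2 * real h" "real (n - h) / real (h + 1) = real h / (real h + 1)"
      "real (n - h - 1) / real (h + 2) = (real h - 1) / (real h + 2)"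
      using h k by (auto simp: of_nat_diff)
    show "(1 + 8 * (-8 + 6 * real n ^ 2 + real n ^ 3) /
               ((-1 + real n) * (2 + real n) * (4 + real n) ^ 2 * (-2 + real n ^ 2)))
             * real (n choose (n div 2)) ^ 2 \<le> real r"
    proof (rule le_from_scaled[OF _ _ pos])
      show "(1 + 8 * (-8 + 6 * real n ^ 2 + real n ^ 3) /
               ((-1 + real n) * (2 + real n) * (4 + real n) ^ 2 * (-2 + real n ^ 2)))
          * (((real n)\<^sup>2 - 1) * ((real n)\<^sup>2 - 2) / 2)
          = (real n)\<^sup>2 * ((real n)\<^sup>2 - 1) / 2 - (real h / (real h + 1))\<^sup>2 * (real n)\<^sup>2
            + (real h / (real h + 1) * ((real h - 1) / (real h + 2)))\<^sup>2"
        unfolding x(1) by (rule even_identity) (use k in simp)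
      show "((real n)\<^sup>2 * ((real n)\<^sup>2 - 1) / 2 - (real h / (real h + 1))\<^sup>2 * (real n)\<^sup>2
            + (real h / (real h + 1) * ((real h - 1) / (real h + 2)))\<^sup>2) * real (n choose (n div 2)) ^ 2
          \<le> real r * (((real n)\<^sup>2 - 1) * ((real n)\<^sup>2 - 2) / 2)"
        using border_rank_bound_real[OF k closure] h unfolding x(2,3) by simp
    qed
  next
    assume "odd n"
    then obtain h' where "n = 2 * h' + 1" by (elim oddE)
    \<comment> \<open>\<open>k = h\<close> is the upper middle index; the lower one would be only 2
      for \<open>n = 5\<close>. By symmetry both give the same binomial coefficient.\<close>
    then obtain h where h: "n = 2 * h - 1" "h = h' + 1" by simp
    have k: "3 \<le> h" "h \<le> n" using assms h by auto
    have x: "real n = 2 * real h - 1" "real (n - h) / real (h + 1) = (real h - 1) / (real h + 1)"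
      "real (n - h - 1) / real (h + 2) = (real h - 2) / (real h + 2)"
      using h k by (auto simp: of_nat_diff)
    have sym: "n choose ((n - 1) div 2) = n choose h"
      using binomial_symmetric[of h n] k h by simp
    show "(1 + 16 * (9 + 8 * real n + real n ^ 2) /
               ((3 + real n) * (5 + real n) ^ 2 * (-2 + real n ^ 2)))
             * real (n choose ((n - 1) div 2)) ^ 2 \<le> real r"
      unfolding sym
    proof (rule le_from_scaled[OF _ _ pos])
      show "(1 + 16 * (9 + 8 * real n + real n ^ 2) / ((3 + real n) * (5 + real n) ^ 2 * (-2 + real n ^ 2)))
          * (((real n)\<^sup>2 - 1) * ((real n)\<^sup>2 - 2) / 2)
          = (real n)\<^sup>2 * ((real n)\<^sup>2 - 1) / 2 - ((real h - 1) / (real h + 1))\<^sup>2 * (real n)\<^sup>2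
            + ((real h - 1) / (real h + 1) * ((real h - 2) / (real h + 2)))\<^sup>2"
        unfolding x(1) by (rule odd_identity) (use k in simp)
      show "((real n)\<^sup>2 * ((real n)\<^sup>2 - 1) / 2 - ((real h - 1) / (real h + 1))\<^sup>2 * (real n)\<^sup>2
            + ((real h - 1) / (real h + 1) * ((real h - 2) / (real h + 2)))\<^sup>2) * real (n choose h) ^ 2
          \<le> real r * (((real n)\<^sup>2 - 1) * ((real n)\<^sup>2 - 2) / 2)"
        using border_rank_bound_real[OF k closure] unfolding x(2,3) .
    qed
  }
qed

end
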